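(* Consider the bilevel problem $\min_{\xi\in\Xi}u(\xi)$, $u(\xi)=\mathcal U(\eta^*(\xi),\xi)$, $\eta^*(\xi)=\operatorname{argmin}_{\eta\in H}\mathcal L(\eta,\xi)$, and assume: (A1) $\mathcal U,\nabla\mathcal U,\nabla\mathcal L,\nabla^2\mathcal L$ are Lipschitz continuous with constants $\ell_{u,0},\ell_{u,1},\ell_{l,1},\ell_{l,2}$, respectively; (A2) for any fixed $\xi$, $\mathcal L(\eta,\xi)$ is $\mu_l$-strongly convex with respect to $\eta$; (A3) $\Xi=\{\xi: B\xi=e\}$ is a linear constraint set, and $H$ and $\Xi$ are nonempty. Let $\tau_l\le\frac1{2\ell_{l,1}}$, let $K_l=\mathcal O(\log K_u)$, and let $\tau_u=\mathcal O(1)$ satisfy $$\tau_u\le\min\left\{\frac1{2L_u(1+2L_\eta)},\ \frac{\tau_lL_u\mu_l}{L_\eta\left((\ell_{u,1}(1+L_\eta)+2\ell_{u,0}\,C_{K_l}C_l^2)^2+4L_u^2\right)}\right\}.$$ Then the iterates of the alternating gradient method (described in the context, with $K_u$ upper-level iterations, $K_l$ lower-level iterations per upper-level iteration, and step sizes $\tau_u,\tau_l$) satisfy $$\frac1{K_u}\sum_{k=1}^{K_u}\bigl\|\xi^{k}-\operatorname{Proj}_\Xi(\xi^{k}-\nabla u(\xi^{k}))\bigr\|^2=\mathcal O\Bigl(\frac1{K_u}\Bigr),$$ where $\mathcal O$ omits the logarithmic dependency.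
   Context: Here $H=\{\eta\in\mathbb R^{d_\eta}: A\eta=c\}$ with $A\in\mathbb R^{d_c\times d_\eta}$, $c\in\mathbb R^{d_c}$, $d_c<d_\eta$; $\Xi\subset\mathbb R^{d_u}$; $\mathcal U$ and $\mathcal L$ are real-valued functions of $(\eta,\xi)\in\mathbb R^{d_\eta}\times\mathbb R^{d_u}$. $\operatorname{Proj}$ denotes Euclidean projection. Constants: $L_\eta=\frac{\ell_{l,1}}{\mu_l}$, $L_{\eta\xi}=\frac{\ell_{l,2}(1+\ell_{l,1}/\mu_l)^2}{\mu_l}$, $L_u=\ell_{u,1}(1+L_\eta)^2+\ell_{u,0}L_{\eta\xi}$, $C_l^2=\bigl(1+\frac{\ell_{l,1}}{\mu_l}\bigr)\ell_{l,2}^2\bigl(\frac2{\mu_l^2}+\frac3{2\ell_{l,1}^2}\bigr)$, and $C_{K_l}$ is the upper bound of $K_l(1-\tau_l\mu_l)^{K_l-1}$, viewed as a function of $K_l$ for given $\tau_l$; it is finite. Alternating gradient method: given initial $\xi^1,\eta^1$ and step sizes $\tau_u,\tau_l>0$, for $k=1,\dots,K_u$: set $\eta^{k,1}=\eta^k$; for $s=1,\dots,K_l$ set $\eta^{k,s+1}=\operatorname{Proj}_H\bigl(\eta^{k,s}-\tau_l\nabla_\eta\mathcal L(\eta^{k,s},\xi^k)\bigr)$; set $\eta^{k+1}=\eta^{k,K_l+1}$; set $$\widehat\nabla u(\xi^k)=\nabla_\xi\mathcal U(\eta^{k+1},\xi^k)+(\nabla_{\xi^k}\eta^{k+1})^\top\nabla_\eta\mathcal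 U(\eta^{k+1},\xi^k),$$ where $\nabla_{\xi^k}\eta^{k+1}=\nabla_{\xi^k}\eta^{k,K_l+1}$ is obtained by unrolling (differentiating) the inner iterations: $\nabla_{\xi^k}\eta^{k,1}=0$ and $\nabla_{\xi^k}\eta^{k,s+1}=P\bigl(I-\tau_l\nabla_{\eta\eta}\mathcal L(\eta^{k,s},\xi^k)\bigr)\nabla_{\xi^k}\eta^{k,s}-\tau_lP\,\nabla_{\eta\xi}\mathcal L(\eta^{k,s},\xi^k)$ for $s=1,\dots,K_l$, with $P$ the orthogonal projection matrix onto $\operatorname{Ker}(A)$; finally $\xi^{k+1}=\operatorname{Proj}_\Xi\bigl(\xi^k-\tau_u\widehat\nabla u(\xi^k)\bigr)$.
   Formalization: u is assumed bounded below on Ξ (without this a linear u is a counterexample); K_l = O(log K_u) is read as order log K_u with a sufficiently large constant depending only on the problem and τ_l, and τ_u = O(1) as bounded above and away from zero. *)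

theory Defs
  imports "HOL-Analysis.Analysis" "HOL-Library.Landau_Symbols"
begin

section \<open>Gradients, Hessians, strong convexity\<close>

definition gradient :: "('a::real_inner \<Rightarrow> real) \<Rightarrow> 'a \<Rightarrow> 'a" where
  "gradient f x = (THE D. GDERIV f x :> D)"

lemma gradient_eqI:
  assumes "GDERIV f x :> D"
  shows "gradient f x = D"
  unfolding gradient_def
proof (rule the_equality, rule assms)
  fix E assume "GDERIV f x :> E"
  with assms have "(\<lambda>h. inner h E) = (\<lambda>h. inner h D)"
    unfolding gderiv_def using has_derivative_unique by blast
  then have "inner h (E - D) = 0" for h
    by (metis diff_self inner_diff_right)
  from this[of "E - D"] show "E = D" by simp
qed

lemma GDERIV_gradient:
  fixes f :: "'a::euclidean_space \<Rightarrow> real"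
  assumes "f differentiable (at x)"
  shows "GDERIV f x :> gradient f x"
proof -
  from assms obtain f' where f': "(f has_derivative f') (at x)"
    unfolding differentiable_def by blast
  then have "linear f'" by (rule has_derivative_linear)
  then have "f' = (\<lambda>h. inner h (adjoint f' 1))"
    by (simp add: fun_eq_iff adjoint_works)
  with f' have "GDERIV f x :> adjoint f' 1"
    unfolding gderiv_def by simp
  then show ?thesis using gradient_eqI[of f x] by metis
qed

text \<open>The second derivative as a bounded linear operator, so that distances between Hessians
  are measured in the operator norm. It is meaningful where the gradient is differentiable.\<close>

definition hessian :: "('a::euclidean_space \<Rightarrow> real) \<Rightarrow> 'a \<Rightarrow> ('a \<Rightarrow>\<^sub>L 'a)" where
  "hessian f x = Blinfun (frechet_derivative (gradient f) (at x))"

definition strongly_convex_on :: "'a::real_normed_vector set \<Rightarrow> real \<Rightarrow> ('a \<Rightarrow> real) \<Rightarrow> bool" where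
  "strongly_convex_on S m f \<longleftrightarrow> convex S \<and>
     (\<forall>x\<in>S. \<forall>y\<in>S. \<forall>t\<in>{0..1}.
        f (t *\<^sub>R x + (1 - t) *\<^sub>R y)
          \<le> t * f x + (1 - t) * f y - m / 2 * t * (1 - t) * (norm (x - y))\<^sup>2)"


section \<open>Partial derivatives of functions of a pair \<open>(\<eta>, \<xi>)\<close>\<close>

definition grad_eta :: "('a::real_inner \<times> 'b::real_inner \<Rightarrow> real) \<Rightarrow> 'a \<Rightarrow> 'b \<Rightarrow> 'a" where
  "grad_eta F \<eta> \<xi> = gradient (\<lambda>y. F (y, \<xi>)) \<eta>"

definition grad_xi :: "('a::real_inner \<times> 'b::real_inner \<Rightarrow> real) \<Rightarrow> 'a \<Rightarrow> 'b \<Rightarrow> 'b" where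
  "grad_xi F \<eta> \<xi> = gradient (\<lambda>x. F (\<eta>, x)) \<xi>"

definition hess_eta_eta :: "((real^'n) \<times> (real^'u) \<Rightarrow> real) \<Rightarrow> real^'n \<Rightarrow> real^'u \<Rightarrow> real^'n^'n" where
  "hess_eta_eta F \<eta> \<xi> = jacobian (\<lambda>y. grad_eta F y \<xi>) (at \<eta>)"

definition hess_eta_xi :: "((real^'n) \<times> (real^'u) \<Rightarrow> real) \<Rightarrow> real^'n \<Rightarrow> real^'u \<Rightarrow> real^'u^'n" where
  "hess_eta_xi F \<eta> \<xi> = jacobian (\<lambda>x. grad_eta F \<eta> x) (at \<xi>)"


section \<open>The bilevel objective\<close>

definition lower_solution ::
  "'a set \<Rightarrow> ('a \<times> 'b \<Rightarrow> real) \<Rightarrow> 'b \<Rightarrow> 'a" where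
  "lower_solution H L \<xi> = arg_min_on (\<lambda>\<eta>. L (\<eta>, \<xi>)) H"

definition bilevel_objective ::
  "'a set \<Rightarrow> ('a \<times> 'b \<Rightarrow> real) \<Rightarrow> ('a \<times> 'b \<Rightarrow> real) \<Rightarrow> 'b \<Rightarrow> real" where
  "bilevel_objective H U L \<xi> = U (lower_solution H L \<xi>, \<xi>)"


section \<open>Problem constants\<close>

definition L_eta :: "real \<Rightarrow> real \<Rightarrow> real" where
  "L_eta ll1 \<mu> = ll1 / \<mu>"

definition L_eta_xi :: "real \<Rightarrow> real \<Rightarrow> real \<Rightarrow> real" where
  "L_eta_xi ll1 ll2 \<mu> = ll2 * (1 + ll1 / \<mu>)\<^sup>2 / \<mu>"

definition L_u :: "real \<Rightarrow> real \<Rightarrow> real \<Rightarrow> real \<Rightarrow> real \<Rightarrow> real" where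
  "L_u lu0 lu1 ll1 ll2 \<mu> = lu1 * (1 + L_eta ll1 \<mu>)\<^sup>2 + lu0 * L_eta_xi ll1 ll2 \<mu>"

text \<open>This is \<open>C\<^sub>l\<^sup>2\<close>, not \<open>C\<^sub>l\<close>.\<close>

definition C_l_squared :: "real \<Rightarrow> real \<Rightarrow> real \<Rightarrow> real" where
  "C_l_squared ll1 ll2 \<mu> = (1 + ll1 / \<mu>) * ll2\<^sup>2 * (2 / \<mu>\<^sup>2 + 3 / (2 * ll1\<^sup>2))"

text \<open>The supremum is finite whenever \<open>0 < \<tau> * \<mu> \<le> 1\<close>.\<close>

definition C_K :: "real \<Rightarrow> real \<Rightarrow> real" where
  "C_K \<tau> \<mu> = (SUP K\<in>{1..}. real K * (1 - \<tau> * \<mu>) ^ (K - 1))"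


section \<open>The alternating gradient method\<close>

text \<open>With \<open>\<eta>\<close> the starting point \<open>\<eta>\<^sup>k\<close> and \<open>\<xi> = \<xi>\<^sup>k\<close>, \<open>inner_iter H L \<tau> \<eta> \<xi> s\<close> is
  \<open>\<eta>\<^sup>k\<^sup>,\<^sup>s\<^sup>+\<^sup>1\<close> and \<open>inner_jac A H L \<tau> \<eta> \<xi> s\<close> is its unrolled Jacobian with respect to \<open>\<xi>\<^sup>k\<close>
  (indices start at 0 instead of 1).\<close>

primrec inner_iter ::
  "(real^'n) set \<Rightarrow> ((real^'n) \<times> (real^'u) \<Rightarrow> real) \<Rightarrow> real \<Rightarrow> real^'n \<Rightarrow> real^'u \<Rightarrow> nat \<Rightarrow> real^'n" where
  "inner_iter H L \<tau> \<eta> \<xi> 0 = \<eta>"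
| "inner_iter H L \<tau> \<eta> \<xi> (Suc s) =
     closest_point H (inner_iter H L \<tau> \<eta> \<xi> s - \<tau> *\<^sub>R grad_eta L (inner_iter H L \<tau> \<eta> \<xi> s) \<xi>)"

definition ker_projection :: "real^'n^'m \<Rightarrow> real^'n^'n" where
  "ker_projection A = matrix (closest_point {v. A *v v = 0})"

primrec inner_jac ::
  "real^'n^'m \<Rightarrow> (real^'n) set \<Rightarrow> ((real^'n) \<times> (real^'u) \<Rightarrow> real) \<Rightarrow> real \<Rightarrow> real^'n \<Rightarrow> real^'u
     \<Rightarrow> nat \<Rightarrow> real^'u^'n" where
  "inner_jac A H L \<tau> \<eta> \<xi> 0 = 0"
| "inner_jac A H L \<tau> \<eta> \<xi> (Suc s) =
     ker_projection A ** (mat 1 - \<tau> *\<^sub>R hess_eta_eta L (inner_iter H L \<tau> \<eta> \<xi> s) \<xi>)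
         ** inner_jac A H L \<tau> \<eta> \<xi> s
       - \<tau> *\<^sub>R (ker_projection A ** hess_eta_xi L (inner_iter H L \<tau> \<eta> \<xi> s) \<xi>)"

definition hypergrad ::
  "real^'n^'m \<Rightarrow> (real^'n) set \<Rightarrow> ((real^'n) \<times> (real^'u) \<Rightarrow> real) \<Rightarrow> ((real^'n) \<times> (real^'u) \<Rightarrow> real)
     \<Rightarrow> real \<Rightarrow> nat \<Rightarrow> real^'n \<Rightarrow> real^'u \<Rightarrow> real^'u" where
  "hypergrad A H U L \<tau> Kl \<eta> \<xi> =
     grad_xi U (inner_iter H L \<tau> \<eta> \<xi> Kl) \<xi>
       + transpose (inner_jac A H L \<tau> \<eta> \<xi> Kl) *v grad_eta U (inner_iter H L \<tau> \<eta> \<xi> Kl) \<xi>"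

text \<open>\<open>agm A H \<Xi> U L \<tau>u \<tau>l Kl \<eta>1 \<xi>1 k\<close> is the pair \<open>(\<eta>\<^sup>k\<^sup>+\<^sup>1, \<xi>\<^sup>k\<^sup>+\<^sup>1)\<close>.\<close>

primrec agm ::
  "real^'n^'m \<Rightarrow> (real^'n) set \<Rightarrow> (real^'u) set
     \<Rightarrow> ((real^'n) \<times> (real^'u) \<Rightarrow> real) \<Rightarrow> ((real^'n) \<times> (real^'u) \<Rightarrow> real)
     \<Rightarrow> real \<Rightarrow> real \<Rightarrow> nat \<Rightarrow> real^'n \<Rightarrow> real^'u \<Rightarrow> nat \<Rightarrow> (real^'n) \<times> (real^'u)" where
  "agm A H \<Xi> U L \<tau>u \<tau>l Kl \<eta>1 \<xi>1 0 = (\<eta>1, \<xi>1)"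
| "agm A H \<Xi> U L \<tau>u \<tau>l Kl \<eta>1 \<xi>1 (Suc k) =
     (let (\<eta>, \<xi>) = agm A H \<Xi> U L \<tau>u \<tau>l Kl \<eta>1 \<xi>1 k
      in (inner_iter H L \<tau>l \<eta> \<xi> Kl,
          closest_point \<Xi> (\<xi> - \<tau>u *\<^sub>R hypergrad A H U L \<tau>l Kl \<eta> \<xi>)))"

definition agm_xi ::
  "real^'n^'m \<Rightarrow> (real^'n) set \<Rightarrow> (real^'u) set
     \<Rightarrow> ((real^'n) \<times> (real^'u) \<Rightarrow> real) \<Rightarrow> ((real^'n) \<times> (real^'u) \<Rightarrow> real)
     \<Rightarrow> real \<Rightarrow> real \<Rightarrow> nat \<Rightarrow> real^'n \<Rightarrow> real^'u \<Rightarrow> nat \<Rightarrow> real^'u" where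
  "agm_xi A H \<Xi> U L \<tau>u \<tau>l Kl \<eta>1 \<xi>1 k = snd (agm A H \<Xi> U L \<tau>u \<tau>l Kl \<eta>1 \<xi>1 (k - 1))"

definition stationarity_residual :: "'b::euclidean_space set \<Rightarrow> ('b \<Rightarrow> real) \<Rightarrow> 'b \<Rightarrow> real" where
  "stationarity_residual \<Xi> u \<xi> = (norm (\<xi> - closest_point \<Xi> (\<xi> - gradient u \<xi>)))\<^sup>2"


section \<open>Asymptotic order up to logarithmic factors\<close>

definition soft_O :: "(nat \<Rightarrow> real) \<Rightarrow> (nat \<Rightarrow> real) set" where
  "soft_O g = {f. \<exists>p::nat. f \<in> O(\<lambda>n. g n * ln (real n) ^ p)}"

end

(*
The unrolled gradient step eta -> eta - tau_l grad L is a contraction with factor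
rho = 1 - tau_l mu / 2 (cocoercivity of the gradient of a smooth convex function), and so is its
derivative. Hence each inner loop reduces the lower-level error by rho ^ K_l, and the unrolled
Jacobian approaches the derivative of eta* (given by the implicit function equation) at any slower
rate sigma ^ K_l. Upper-level steps are uniformly bounded, so the tracking error
|eta^k - eta*(xi^k)| stays bounded without any step-size coupling, and the hypergradient is accurate
up to C sigma ^ K_l, which is at most C / sqrt K_u as soon as K_l >= ln K_u / (-2 ln sigma). Since u
is L_u-smooth and tau_u L_u <= 1/2, each upper-level step decreases u by tau_u/2 times the squared
residual up to tau_u/2 times the squared hypergradient error; the sum telescopes, and no logarithmic
factor remains.
*)
theory Submission
  imports Defs
begin

section \<open>Orthogonal projection onto subspaces and affine sets\<close>

text \<open>Both constraint sets are affine, so projecting means applying, up to a translation, the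
  linear orthogonal projection onto the direction space. Projected steps are then differentiable
  like plain ones, and at a feasible point the residual is the squared norm of a projected gradient.
  The estimates threaten to be circular: hypergradient accuracy needs a bound on the tracking error,
  this needs a bound on the upper-level steps, and this needs a bound on the hypergradient. The
  circle is broken by a bound on the unrolled Jacobian that is uniform in the number of inner steps
  and does not refer to the distance from the optimum. Since K_l and tau_u may vary with K_u, every
  constant must be uniform in both; only a fixed upper bound and an eventual positive lower bound on
  tau_u enter. The starting points need not be feasible, so the first upper-level iterate is treated
  apart. Gradients and Jacobians are handled through their action on a direction h, so the analysis
  needs linear maps and inner products only; matrices return at the end.\<close>

lemma closest_point_subspace_orthogonal:
  fixes V :: "'a::euclidean_space set"
  assumes "subspace V" "v \<in> V"
  shows "(x - closest_point V x) \<bullet> v = 0"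
proof -
  have V: "convex V" "closed V" "V \<noteq> {}"
    using assms(1) subspace_imp_convex closed_subspace subspace_0 by auto
  have P: "closest_point V x \<in> V"
    using V by (simp add: closest_point_in_set)
  \<comment> \<open>The variational inequality is tested on both sides of the projection, which
    turns it into an equality.\<close>
  have "closest_point V x + v \<in> V" "closest_point V x - v \<in> V"
    using P assms by (auto simp: subspace_add subspace_diff)
  from this[THEN closest_point_dot[OF V(1,2), of _ x]]
  show ?thesis by (simp add: inner_diff_right)
qed

text \<open>Pythagoras: a residual orthogonal to the direction space certifies a nearest point. All
  later formulas for projections are checked against this certificate.\<close>

lemma closest_point_affine_eqI:
  fixes V :: "'a::euclidean_space set"
  assumes V: "subspace V" and H: "H = {x. x - p \<in> V}"
    and y: "y \<in> H" and orth: "\<And>v. v \<in> V \<Longrightarrow> (x - y) \<bullet> v = 0"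
  shows "closest_point H x = y"
proof -
  have *: "H = (+) p ` V"
    unfolding H by (auto simp: image_iff) (metis add_diff_cancel_left' diff_add_cancel add.commute)
  have cc: "convex H" "closed H"
    unfolding * using V by (simp_all add: convex_translation subspace_imp_convex closed_translation closed_subspace)
  have "dist x y \<le> dist x z" if "z \<in> H" for z
  proof -
    have "y - z \<in> V"
      using subspace_diff[OF V, of "y - p" "z - p"] y that H by simp
    then have "(x - y) \<bullet> (y - z) = 0" by (rule orth)
    then have "(norm (x - z))\<^sup>2 = (norm (x - y))\<^sup>2 + (norm (y - z))\<^sup>2"
      using dot_norm[of "x - y" "y - z"] by simp
    then show ?thesis
      unfolding dist_norm by (intro power2_le_imp_le[of "norm (x - y)"]) auto
  qed
  then show ?thesis
    using closest_point_unique[OF cc y] by simp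
qed

lemma closest_point_subspace_eqI:
  fixes V :: "'a::euclidean_space set"
  assumes "subspace V" "y \<in> V" "\<And>v. v \<in> V \<Longrightarrow> (x - y) \<bullet> v = 0"
  shows "closest_point V x = y"
  using closest_point_affine_eqI[of V V 0 y x] assms by simp

lemma closest_point_in_subspace:
  fixes V :: "'a::euclidean_space set"
  assumes "subspace V"
  shows "closest_point V x \<in> V"
  using assms by (metis closed_subspace closest_point_in_set empty_iff subspace_0)

lemma linear_closest_point_subspace:
  fixes V :: "'a::euclidean_space set"
  assumes V: "subspace V"
  shows "linear (closest_point V)"
proof (rule linearI)
  fix x y :: 'a and r :: real
  note orth = closest_point_subspace_orthogonal[OF V]
  show "closest_point V (x + y) = closest_point V x + closest_point V y"
    using V orth[of _ x] orth[of _ y]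
    by (intro closest_point_subspace_eqI)
       (auto simp: subspace_add closest_point_in_subspace inner_diff_left inner_add_left)
  show "closest_point V (r *\<^sub>R x) = r *\<^sub>R closest_point V x"
    using V orth[of _ x]
    by (intro closest_point_subspace_eqI)
       (auto simp: subspace_scale closest_point_in_subspace inner_diff_left)
qed

lemma inner_closest_point_subspace:
  fixes V :: "'a::euclidean_space set"
  assumes "subspace V" "v \<in> V"
  shows "closest_point V x \<bullet> v = x \<bullet> v"
  using closest_point_subspace_orthogonal[OF assms, of x] by (simp add: inner_diff_left)

lemma norm_closest_point_subspace_le:
  fixes V :: "'a::euclidean_space set"
  assumes V: "subspace V"
  shows "norm (closest_point V x) \<le> norm x"
proof -
  have "(norm (closest_point V x))\<^sup>2 = x \<bullet> closest_point V x"
    using inner_closest_point_subspace[OF V closest_point_in_subspace[OF V], of x x]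
    by (simp add: power2_norm_eq_inner)
  also have "\<dots> \<le> norm x * norm (closest_point V x)"
    by (rule norm_cauchy_schwarz)
  finally show ?thesis
    by (cases "norm (closest_point V x) = 0") (auto simp: power2_eq_square)
qed

lemma closest_point_affine:
  fixes V :: "'a::euclidean_space set"
  assumes V: "subspace V" and H: "H = {x. x - p \<in> V}" and q: "q \<in> H"
  shows "closest_point H x = q + closest_point V (x - q)"
proof (rule closest_point_affine_eqI[OF V H])
  show "q + closest_point V (x - q) \<in> H"
    using q subspace_add[OF V _ closest_point_in_subspace[OF V], of "q - p" "x - q"]
    unfolding H by (simp add: algebra_simps)
  fix v assume "v \<in> V"
  then show "(x - (q + closest_point V (x - q))) \<bullet> v = 0"
    using closest_point_subspace_orthogonal[OF V, of v "x - q"] by (simp add: algebra_simps)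
qed

text \<open>From a feasible point, projecting a gradient step is the same as stepping along the
  projected gradient.\<close>

lemma closest_point_affine_minus:
  fixes V :: "'a::euclidean_space set"
  assumes "subspace V" "H = {x. x - p \<in> V}" "x \<in> H"
  shows "closest_point H (x - g) = x - closest_point V g"
  using closest_point_affine[OF assms, of "x - g"] linear_closest_point_subspace[OF assms(1)]
  by (simp add: linear_neg)

lemma solution_set_affine:
  fixes A :: "real^'n^'m"
  assumes "p \<in> {x. A *v x = c}"
  shows "subspace {v. A *v v = 0}" and "{x. A *v x = c} = {x. x - p \<in> {v. A *v v = 0}}"
  using assms
  by (auto simp: subspace_def matrix_vector_right_distrib matrix_vector_mult_scaleR
      matrix_vector_mult_diff_distrib)

section \<open>Smooth and strongly convex functions\<close>

text \<open>One-sided quotients suffice to carry inequalities between function values over to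
  derivatives, and dividing by a positive \<open>t\<close> preserves the direction of an
  inequality.\<close>

lemma tendsto_directional_quotient:
  fixes f :: "'a::real_normed_vector \<Rightarrow> 'b::real_normed_vector"
  assumes "(f has_derivative f') (at x)"
  shows "((\<lambda>t. (f (x + t *\<^sub>R v) - f x) /\<^sub>R t) \<longlongrightarrow> f' v) (at_right 0)"
proof -
  have f: "(f has_derivative f') (at (x + 0 *\<^sub>R v))" using assms by simp
  have "((\<lambda>t. x + t *\<^sub>R v) has_derivative (\<lambda>t. t *\<^sub>R v)) (at 0)"
    by (auto intro!: derivative_eq_intros)
  from diff_chain_at[OF this f]
  have "((\<lambda>t. f (x + t *\<^sub>R v)) has_vector_derivative f' v) (at 0)"
    using bounded_linear.linear[OF has_derivative_bounded_linear[OF assms]]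
    by (simp add: has_vector_derivative_def o_def linear_scale)
  then have "((\<lambda>t. norm (f (x + t *\<^sub>R v) - f x - t *\<^sub>R f' v) / norm t) \<longlongrightarrow> 0) (at 0)"
    unfolding has_vector_derivative_def has_derivative_at by simp
  then have "((\<lambda>t. norm ((f (x + t *\<^sub>R v) - f x) /\<^sub>R t - f' v)) \<longlongrightarrow> 0) (at 0)"
  proof (rule Lim_transform_eventually)
    have "norm (f (x + t *\<^sub>R v) - f x - t *\<^sub>R f' v) / norm t
        = norm ((f (x + t *\<^sub>R v) - f x) /\<^sub>R t - f' v)" if "t \<noteq> 0" for t
    proof -
      have "(f (x + t *\<^sub>R v) - f x) /\<^sub>R t - f' v = (f (x + t *\<^sub>R v) - f x - t *\<^sub>R f' v) /\<^sub>R t"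
        using that by (simp add: scaleR_diff_right)
      then show ?thesis by (simp add: divide_inverse mult.commute)
    qed
    then show "\<forall>\<^sub>F t in at 0. norm (f (x + t *\<^sub>R v) - f x - t *\<^sub>R f' v) / norm t
        = norm ((f (x + t *\<^sub>R v) - f x) /\<^sub>R t - f' v)"
      by (auto simp: eventually_at_filter)
  qed
  then have "((\<lambda>t. (f (x + t *\<^sub>R v) - f x) /\<^sub>R t) \<longlongrightarrow> f' v) (at 0)"
    by (metis Lim_null tendsto_norm_zero_cancel)
  then show ?thesis
    by (rule filterlim_mono) (auto simp: at_le)
qed

lemma GDERIV_along_line:
  assumes "GDERIV f (x + t *\<^sub>R d) :> g"
  shows "((\<lambda>s. f (x + s *\<^sub>R d)) has_real_derivative g \<bullet> d) (at t)"
proof -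
  have "((\<lambda>s. x + s *\<^sub>R d) has_derivative (\<lambda>s. s *\<^sub>R d)) (at t)"
    by (auto intro!: derivative_eq_intros)
  from diff_chain_at[OF this assms[unfolded gderiv_def]]
  show ?thesis
    by (simp add: has_field_derivative_def o_def inner_commute[of g] mult.commute[of "inner _ _"]
        mult_commute_abs)
qed

lemma descent_lemma:
  fixes f :: "'a::real_inner \<Rightarrow> real"
  assumes f: "\<And>x. GDERIV f x :> g x"
    and g: "\<And>x y. norm (g x - g y) \<le> l * norm (x - y)"
  shows "f y \<le> f x + g x \<bullet> (y - x) + l / 2 * (norm (y - x))\<^sup>2"
proof -
  define d where "d = y - x"
  \<comment> \<open>\<open>\<phi>\<close> is the function along the segment minus its quadratic
    upper model, up to a constant; the Lipschitz bound makes its derivative nonpositive.\<close>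
  define \<phi> where "\<phi> t = f (x + t *\<^sub>R d) - t * (g x \<bullet> d) - l / 2 * t\<^sup>2 * (norm d)\<^sup>2" for t
  have "\<phi> 0 \<ge> \<phi> 1"
  proof (rule DERIV_nonpos_imp_nonincreasing[of 0 1 \<phi>])
    fix t :: real assume t: "0 \<le> t" "t \<le> 1"
    have 1: "(\<phi> has_real_derivative (g (x + t *\<^sub>R d) \<bullet> d - g x \<bullet> d - l * t * (norm d)\<^sup>2)) (at t)"
      unfolding \<phi>_def by (auto intro!: derivative_eq_intros GDERIV_along_line f)
    have "(g (x + t *\<^sub>R d) - g x) \<bullet> d \<le> norm (g (x + t *\<^sub>R d) - g x) * norm d"
      by (rule norm_cauchy_schwarz)
    also have "\<dots> \<le> (l * norm (x + t *\<^sub>R d - x)) * norm d"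
      by (intro mult_right_mono g) auto
    also have "\<dots> = l * t * (norm d)\<^sup>2"
      using t by (simp add: power2_eq_square)
    finally show "\<exists>D. (\<phi> has_real_derivative D) (at t) \<and> D \<le> 0"
      using 1 by (auto simp: inner_diff_left)
  qed auto
  then show ?thesis
    by (simp add: \<phi>_def d_def)
qed

text \<open>The convexity inequality along the segment is divided by \<open>t\<close>, and
  \<open>t\<close> tends to 0 from the right.\<close>

lemma strongly_convex_on_first_order:
  fixes f :: "'a::real_inner \<Rightarrow> real"
  assumes sc: "strongly_convex_on UNIV m f" and f: "GDERIV f x :> g"
  shows "f y \<ge> f x + g \<bullet> (y - x) + m / 2 * (norm (y - x))\<^sup>2"
proof -
  have "((\<lambda>t. (f (x + t *\<^sub>R (y - x)) - f x) /\<^sub>R t) \<longlongrightarrow> (y - x) \<bullet> g) (at_right 0)"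
    using tendsto_directional_quotient[OF f[unfolded gderiv_def]] .
  moreover have "((\<lambda>t. f y - f x - m / 2 * (1 - t) * (norm (y - x))\<^sup>2)
      \<longlongrightarrow> f y - f x - m / 2 * (1 - 0) * (norm (y - x))\<^sup>2) (at_right 0)"
    by (intro tendsto_intros)
  moreover have "\<forall>\<^sub>F t in at_right 0. (f (x + t *\<^sub>R (y - x)) - f x) /\<^sub>R t
      \<le> f y - f x - m / 2 * (1 - t) * (norm (y - x))\<^sup>2"
  proof -
    have "(f (x + t *\<^sub>R (y - x)) - f x) /\<^sub>R t \<le> f y - f x - m / 2 * (1 - t) * (norm (y - x))\<^sup>2"
      if t: "0 < t" "t < 1" for t
    proof -
      have "f (t *\<^sub>R y + (1 - t) *\<^sub>R x) \<le> t * f y + (1 - t) * f x - m / 2 * t * (1 - t) * (norm (y - x))\<^sup>2"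
        using sc t unfolding strongly_convex_on_def by auto
      also have "t *\<^sub>R y + (1 - t) *\<^sub>R x = x + t *\<^sub>R (y - x)"
        by (simp add: algebra_simps)
      finally have "f (x + t *\<^sub>R (y - x)) - f x \<le> t * (f y - f x - m / 2 * (1 - t) * (norm (y - x))\<^sup>2)"
        by (simp add: algebra_simps)
      then show ?thesis
        using t by (simp add: field_simps)
    qed
    then show ?thesis
      by (auto simp: eventually_at_right_field intro!: exI[of _ 1])
  qed
  ultimately have "(y - x) \<bullet> g \<le> f y - f x - m / 2 * (1 - 0) * (norm (y - x))\<^sup>2"
    by (intro tendsto_le[where F = "at_right (0::real)"]) auto
  then show ?thesis by (simp add: inner_commute)
qed

lemma strongly_convex_on_grad_monotone:
  fixes f :: "'a::real_inner \<Rightarrow> real"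
  assumes sc: "strongly_convex_on UNIV m f" and f: "\<And>x. GDERIV f x :> g x"
  shows "(g x - g y) \<bullet> (x - y) \<ge> m * (norm (x - y))\<^sup>2"
  using strongly_convex_on_first_order[OF sc f, of x y] strongly_convex_on_first_order[OF sc f, of y x]
  by (simp add: inner_diff norm_minus_commute field_simps)

text \<open>Baillon--Haddad: compare the value of \<open>\<lambda>y. f y - g x \<bullet> y\<close> at its minimizer \<open>x\<close> with that
  after a gradient step from \<open>y\<close>.\<close>

lemma convex_smooth_cocoercive:
  fixes f :: "'a::real_inner \<Rightarrow> real"
  assumes sc: "strongly_convex_on UNIV m f" and m: "m \<ge> 0" and l: "l > 0"
    and f: "\<And>x. GDERIV f x :> g x"
    and g: "\<And>x y. norm (g x - g y) \<le> l * norm (x - y)"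
  shows "(norm (g x - g y))\<^sup>2 \<le> l * ((g x - g y) \<bullet> (x - y))"
proof -
  have half: "f x - g x \<bullet> x \<le> f y - g x \<bullet> y - (norm (g y - g x))\<^sup>2 / (2 * l)" for x y
  proof -
    \<comment> \<open>A step of length \<open>1 / l\<close> minimizes the quadratic upper model of
      the tilted function at \<open>y\<close>.\<close>
    define z where "z = y - (g y - g x) /\<^sub>R l"
    have "f x + g x \<bullet> (z - x) \<le> f z"
      using strongly_convex_on_first_order[OF sc f, of x z] m
      by (smt (verit) divide_nonneg_nonneg mult_nonneg_nonneg zero_le_power2)
    also have "f z \<le> f y + g y \<bullet> (z - y) + l / 2 * (norm (z - y))\<^sup>2"
      by (rule descent_lemma[OF f g])
    finally have "f x + g x \<bullet> (z - x) \<le> f y + g y \<bullet> (z - y) + l / 2 * (norm (z - y))\<^sup>2" .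
    moreover have "l / 2 * (norm (z - y))\<^sup>2 = (norm (g y - g x))\<^sup>2 / (2 * l)"
    proof -
      have "norm (z - y) = norm (g y - g x) / l"
        using l by (simp add: z_def norm_minus_commute divide_inverse mult.commute)
      then show ?thesis
        using l by (simp add: power_divide power2_eq_square)
    qed
    moreover have "(g y - g x) \<bullet> (z - y) = - (norm (g y - g x))\<^sup>2 / l"
    proof -
      have "(g y - g x) \<bullet> (z - y) = - (inverse l * (norm (g y - g x))\<^sup>2)"
        unfolding power2_norm_eq_inner by (simp add: z_def)
      then show ?thesis by (simp add: divide_inverse)
    qed
    moreover have "(norm (g y - g x))\<^sup>2 / l = 2 * ((norm (g y - g x))\<^sup>2 / (2 * l))"
      by simp
    ultimately show ?thesis
      unfolding inner_diff_left inner_diff_right by linarith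
  qed
  have "(norm (g x - g y))\<^sup>2 / l \<le> (g x - g y) \<bullet> (x - y)"
    using half[of x y] half[of y x]
    by (simp add: norm_minus_commute inner_diff_left inner_diff_right)
  then show ?thesis using l by (simp add: field_simps)
qed

text \<open>In the expanded square, cocoercivity and \<open>\<tau> * l \<le> 1\<close> let half of
  the cross term pay for the quadratic term; strong monotonicity turns the other half into
  decrease.\<close>

lemma gradient_step_contraction:
  fixes f :: "'a::real_inner \<Rightarrow> real"
  assumes sc: "strongly_convex_on UNIV m f" and m: "m \<ge> 0" and l: "l > 0"
    and f: "\<And>x. GDERIV f x :> g x"
    and g: "\<And>x y. norm (g x - g y) \<le> l * norm (x - y)"
    and \<tau>: "0 \<le> \<tau>" "\<tau> * l \<le> 1" "\<tau> * m \<le> 2"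
  shows "norm ((x - \<tau> *\<^sub>R g x) - (y - \<tau> *\<^sub>R g y)) \<le> (1 - \<tau> * m / 2) * norm (x - y)"
proof (rule power2_le_imp_le)
  define d where "d = g x - g y"
  define v where "v = x - y"
  have coco: "(norm d)\<^sup>2 \<le> l * (d \<bullet> v)"
    unfolding d_def v_def by (rule convex_smooth_cocoercive[OF sc m l f g])
  have mono: "d \<bullet> v \<ge> m * (norm v)\<^sup>2"
    unfolding d_def v_def by (rule strongly_convex_on_grad_monotone[OF sc f])
  have dv: "d \<bullet> v \<ge> 0"
    using mono m by (meson mult_nonneg_nonneg order_trans zero_le_power2)
  have "(norm (v - \<tau> *\<^sub>R d))\<^sup>2 = (norm v)\<^sup>2 - 2 * \<tau> * (d \<bullet> v) + \<tau>\<^sup>2 * (norm d)\<^sup>2"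
    unfolding power2_norm_eq_inner
    by (simp add: inner_diff algebra_simps inner_commute power2_eq_square)
  also have "\<dots> \<le> (norm v)\<^sup>2 - 2 * \<tau> * (d \<bullet> v) + \<tau>\<^sup>2 * (l * (d \<bullet> v))"
    using coco by (simp add: mult_left_mono)
  also have "\<tau>\<^sup>2 * (l * (d \<bullet> v)) = (\<tau> * l) * (\<tau> * (d \<bullet> v))"
    by (simp add: power2_eq_square)
  also have "\<dots> \<le> 1 * (\<tau> * (d \<bullet> v))"
    using \<tau> dv by (intro mult_right_mono) auto
  also have "(norm v)\<^sup>2 - 2 * \<tau> * (d \<bullet> v) + 1 * (\<tau> * (d \<bullet> v)) = (norm v)\<^sup>2 - \<tau> * (d \<bullet> v)"
    by simp
  also have "\<dots> \<le> (norm v)\<^sup>2 - \<tau> * (m * (norm v)\<^sup>2)"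
    using mono \<tau> by (simp add: mult_left_mono)
  \<comment> \<open>Completing the square replaces the factor \<open>sqrt (1 - \<tau> * m)\<close>
    by the simpler \<open>1 - \<tau> * m / 2\<close>.\<close>
  also have "\<dots> \<le> (norm v)\<^sup>2 - \<tau> * (m * (norm v)\<^sup>2) + (\<tau> * m / 2 * norm v)\<^sup>2"
    by simp
  also have "\<dots> = ((1 - \<tau> * m / 2) * norm v)\<^sup>2"
    by (simp add: power2_eq_square algebra_simps)
  finally show "(norm ((x - \<tau> *\<^sub>R g x) - (y - \<tau> *\<^sub>R g y)))\<^sup>2 \<le> ((1 - \<tau> * m / 2) * norm (x - y))\<^sup>2"
    by (simp add: d_def v_def algebra_simps)
  \<comment> \<open>Squares may be removed because \<open>\<tau> * m \<le> 2\<close> keeps the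
    factor nonnegative.\<close>
  show "0 \<le> (1 - \<tau> * m / 2) * norm (x - y)"
    using \<tau> by simp
qed

text \<open>The difference quotients obey the bound, hence so does their limit. Applied to the
  gradient step, this gives its derivative the same contraction factor.\<close>

lemma has_derivative_norm_le:
  fixes f :: "'a::real_normed_vector \<Rightarrow> 'b::real_normed_vector"
  assumes f: "(f has_derivative f') (at x)"
    and lip: "\<And>y. norm (f y - f x) \<le> l * norm (y - x)"
  shows "norm (f' v) \<le> l * norm v"
proof (rule tendsto_upperbound)
  show "((\<lambda>t. norm ((f (x + t *\<^sub>R v) - f x) /\<^sub>R t)) \<longlongrightarrow> norm (f' v)) (at_right 0)"
    by (intro tendsto_norm tendsto_directional_quotient[OF f])
  have "norm ((f (x + t *\<^sub>R v) - f x) /\<^sub>R t) \<le> l * norm v" if "t > 0" for t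
  proof -
    have "norm ((f (x + t *\<^sub>R v) - f x) /\<^sub>R t) = norm (f (x + t *\<^sub>R v) - f x) / t"
      using that by (simp add: divide_inverse mult.commute)
    also have "\<dots> \<le> l * norm (t *\<^sub>R v) / t"
      using lip[of "x + t *\<^sub>R v"] that by (intro divide_right_mono) auto
    finally show ?thesis using that by simp
  qed
  then show "\<forall>\<^sub>F t in at_right 0. norm ((f (x + t *\<^sub>R v) - f x) /\<^sub>R t) \<le> l * norm v"
    by (auto simp: eventually_at_filter)
qed simp

lemma has_derivative_coercive:
  fixes g :: "'a::real_inner \<Rightarrow> 'a"
  assumes g: "(g has_derivative g') (at x)"
    and mono: "\<And>y. (g y - g x) \<bullet> (y - x) \<ge> m * (norm (y - x))\<^sup>2"
  shows "g' v \<bullet> v \<ge> m * (norm v)\<^sup>2"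
proof (rule tendsto_lowerbound)
  show "((\<lambda>t. ((g (x + t *\<^sub>R v) - g x) /\<^sub>R t) \<bullet> v) \<longlongrightarrow> g' v \<bullet> v) (at_right 0)"
    by (intro tendsto_intros tendsto_directional_quotient[OF g])
  have "m * (norm v)\<^sup>2 \<le> ((g (x + t *\<^sub>R v) - g x) /\<^sub>R t) \<bullet> v" if "t > 0" for t
  proof -
    have "m * (norm v)\<^sup>2 = m * (norm (t *\<^sub>R v))\<^sup>2 / t\<^sup>2"
      using that by (simp add: power_mult_distrib)
    also have "\<dots> \<le> ((g (x + t *\<^sub>R v) - g x) \<bullet> (t *\<^sub>R v)) / t\<^sup>2"
      using mono[of "x + t *\<^sub>R v"] by (intro divide_right_mono) auto
    also have "\<dots> = ((g (x + t *\<^sub>R v) - g x) /\<^sub>R t) \<bullet> v"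
      using that by (simp add: power2_eq_square divide_inverse)
    finally show ?thesis .
  qed
  then show "\<forall>\<^sub>F t in at_right 0. m * (norm v)\<^sup>2 \<le> ((g (x + t *\<^sub>R v) - g x) /\<^sub>R t) \<bullet> v"
    by (auto simp: eventually_at_filter)
qed simp

section \<open>The lower-level solution map\<close>

lemma GDERIV_partial:
  fixes F :: "'a::euclidean_space \<times> 'b::euclidean_space \<Rightarrow> real"
  assumes "F differentiable (at (x, y))"
  shows "GDERIV (\<lambda>x. F (x, y)) x :> fst (gradient F (x, y))"
    and "GDERIV (\<lambda>y. F (x, y)) y :> snd (gradient F (x, y))"
proof -
  have F: "(F has_derivative (\<lambda>h. h \<bullet> gradient F (x, y))) (at (x, y))"
    using GDERIV_gradient[OF assms] by (simp add: gderiv_def)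
  have "((\<lambda>x. (x, y)) has_derivative (\<lambda>h. (h, 0))) (at x)"
    by (auto intro!: derivative_eq_intros)
  from diff_chain_at[OF this F] show "GDERIV (\<lambda>x. F (x, y)) x :> fst (gradient F (x, y))"
    by (simp add: gderiv_def o_def inner_prod_def)
  have "((\<lambda>y. (x, y)) has_derivative (\<lambda>h. (0, h))) (at y)"
    by (auto intro!: derivative_eq_intros)
  from diff_chain_at[OF this F] show "GDERIV (\<lambda>y. F (x, y)) y :> snd (gradient F (x, y))"
    by (simp add: gderiv_def o_def inner_prod_def)
qed

lemma grad_eta_eq:
  fixes F :: "'a::euclidean_space \<times> 'b::euclidean_space \<Rightarrow> real"
  assumes "F differentiable (at (x, y))"
  shows "grad_eta F x y = fst (gradient F (x, y))"
  unfolding grad_eta_def by (rule gradient_eqI[OF GDERIV_partial(1)[OF assms]])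

lemma grad_xi_eq:
  fixes F :: "'a::euclidean_space \<times> 'b::euclidean_space \<Rightarrow> real"
  assumes "F differentiable (at (x, y))"
  shows "grad_xi F x y = snd (gradient F (x, y))"
  unfolding grad_xi_def by (rule gradient_eqI[OF GDERIV_partial(2)[OF assms]])

lemma has_derivative_gradient:
  assumes "gradient F differentiable (at z)"
  shows "(gradient F has_derivative blinfun_apply (hessian F z)) (at z)"
proof -
  have D: "(gradient F has_derivative frechet_derivative (gradient F) (at z)) (at z)"
    using assms by (simp add: frechet_derivative_works)
  then have "bounded_linear (frechet_derivative (gradient F) (at z))"
    by (rule has_derivative_bounded_linear)
  with D show ?thesis
    by (simp add: hessian_def bounded_linear_Blinfun_apply)
qed

lemma norm_fst_le_norm: "norm (fst z) \<le> norm z"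
  by (metis norm_fst_le prod.collapse)

locale strongly_convex_lower_level =
  fixes V H :: "'a::euclidean_space set" and p :: 'a
    and L :: "'a \<times> 'b::euclidean_space \<Rightarrow> real" and l1 l2 m \<tau> :: real
  assumes subspace_V: "subspace V" and H_def: "H = {x. x - p \<in> V}"
    and L_differentiable: "\<And>z. L differentiable (at z)"
    and grad_differentiable: "\<And>z. gradient L differentiable (at z)"
    and grad_lipschitz: "l1-lipschitz_on UNIV (gradient L)"
    and hess_lipschitz: "l2-lipschitz_on UNIV (hessian L)"
    and m_pos: "m > 0" and strongly_convex: "\<And>\<xi>. strongly_convex_on UNIV m (\<lambda>\<eta>. L (\<eta>, \<xi>))"
    and \<tau>_pos: "\<tau> > 0" and \<tau>_le: "\<tau> \<le> 1 / (2 * l1)"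
begin

section \<open>The partial gradient in \<eta> and the projected gradient step\<close>

definition G :: "'a \<Rightarrow> 'b \<Rightarrow> 'a" where "G x \<xi> = fst (gradient L (x, \<xi>))"

text \<open>The derivative of \<open>G\<close> in both variables at once: \<open>M z (v, 0)\<close>
  and \<open>M z (0, h)\<close> are the \<eta>\<eta> and \<eta>\<xi> blocks of the Hessian applied
  to vectors.\<close>

definition M :: "'a \<times> 'b \<Rightarrow> 'a \<times> 'b \<Rightarrow> 'a" where "M z h = fst (hessian L z h)"

abbreviation P :: "'a \<Rightarrow> 'a" where "P \<equiv> closest_point V"

abbreviation opt :: "'b \<Rightarrow> 'a" where "opt \<equiv> lower_solution H L"

text \<open>Since \<open>1 / 0 = 0\<close>, the bound on a positive \<open>\<tau>\<close> also
  excludes \<open>l1 = 0\<close>.\<close>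

lemma l1_pos: "l1 > 0"
proof -
  have "1 / (2 * l1) > 0" using \<tau>_pos \<tau>_le by linarith
  then show ?thesis by (simp add: zero_less_divide_iff)
qed

lemma l2_nonneg: "l2 \<ge> 0"
  using hess_lipschitz by (rule lipschitz_on_nonneg)

lemma \<tau>_l1: "\<tau> * l1 \<le> 1 / 2"
  using \<tau>_le l1_pos by (simp add: field_simps)

lemma GDERIV_G: "GDERIV (\<lambda>x. L (x, \<xi>)) x :> G x \<xi>"
  unfolding G_def by (rule GDERIV_partial(1)[OF L_differentiable])

lemma gradient_lipschitz_norm: "norm (gradient L z - gradient L z') \<le> l1 * norm (z - z')"
  using lipschitz_onD[OF grad_lipschitz, of z z'] by (simp add: dist_norm)

lemma hessian_lipschitz_norm: "norm (hessian L z - hessian L z') \<le> l2 * norm (z - z')"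
  using lipschitz_onD[OF hess_lipschitz, of z z'] by (simp add: dist_norm)

lemma G_lipschitz: "norm (G x \<xi> - G y \<zeta>) \<le> l1 * norm ((x, \<xi>) - (y, \<zeta>))"
  using norm_fst_le_norm[of "gradient L (x, \<xi>) - gradient L (y, \<zeta>)"]
    gradient_lipschitz_norm[of "(x, \<xi>)" "(y, \<zeta>)"]
  unfolding G_def by (simp del: diff_Pair)

lemma G_lipschitz_fst: "norm (G x \<xi> - G y \<xi>) \<le> l1 * norm (x - y)"
  using G_lipschitz[of x \<xi> y \<xi>] by (simp add: norm_Pair)

lemma G_lipschitz_snd: "norm (G x \<xi> - G x \<zeta>) \<le> l1 * norm (\<xi> - \<zeta>)"
  using G_lipschitz[of x \<xi> x \<zeta>] by (simp add: norm_Pair)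

lemma G_monotone: "(G x \<xi> - G y \<xi>) \<bullet> (x - y) \<ge> m * (norm (x - y))\<^sup>2"
  by (rule strongly_convex_on_grad_monotone[OF strongly_convex GDERIV_G])

lemma m_le_l1: "m \<le> l1"
proof -
  obtain v :: 'a where v: "norm v = 1"
    using norm_Basis nonempty_Basis by blast
  have "m * (norm (v - 0))\<^sup>2 \<le> (G v 0 - G 0 0) \<bullet> (v - 0)"
    by (rule G_monotone)
  also have "\<dots> \<le> norm (G v 0 - G 0 0) * norm (v - 0)"
    by (rule norm_cauchy_schwarz)
  also have "\<dots> \<le> l1 * norm (v - 0) * norm (v - 0)"
    by (intro mult_right_mono G_lipschitz_fst) auto
  finally show ?thesis using v by simp
qed

lemma \<tau>_m: "\<tau> * m \<le> 1 / 2" "0 < \<tau> * m"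
  using \<tau>_l1 mult_left_mono[OF m_le_l1, of \<tau>] \<tau>_pos m_pos mult_pos_pos[of \<tau> m] by linarith+

definition \<rho> :: real where "\<rho> = 1 - \<tau> * m / 2"

lemma \<rho>_bounds: "0 < \<rho>" "\<rho> < 1"
  using \<tau>_m unfolding \<rho>_def by auto

lemma gradient_step_norm_le:
  "norm ((x - \<tau> *\<^sub>R G x \<xi>) - (y - \<tau> *\<^sub>R G y \<xi>)) \<le> \<rho> * norm (x - y)"
  unfolding \<rho>_def
  using \<tau>_pos \<tau>_l1 \<tau>_m m_pos l1_pos
  by (intro gradient_step_contraction[OF strongly_convex _ _ GDERIV_G G_lipschitz_fst]) auto

lemma p_in_H: "p \<in> H"
  using subspace_0[OF subspace_V] by (simp add: H_def)

lemma closest_point_H_diff: "closest_point H x - closest_point H y = P (x - y)"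
  using closest_point_affine[OF subspace_V H_def p_in_H]
    linear_diff[OF linear_closest_point_subspace[OF subspace_V], of "x - p" "y - p"]
  by simp

lemma closest_point_H_in: "closest_point H x \<in> H"
  using closest_point_affine[OF subspace_V H_def p_in_H, of x]
    closest_point_in_subspace[OF subspace_V] by (simp add: H_def)

lemma closest_point_H_nonexpansive: "norm (closest_point H x - closest_point H y) \<le> norm (x - y)"
  by (simp add: closest_point_H_diff norm_closest_point_subspace_le[OF subspace_V])

lemma projected_step_norm_le:
  "norm (closest_point H (x - \<tau> *\<^sub>R G x \<xi>) - closest_point H (y - \<tau> *\<^sub>R G y \<xi>)) \<le> \<rho> * norm (x - y)"
  using closest_point_H_nonexpansive gradient_step_norm_le order_trans by blast

text \<open>The minimizer is the fixed point of the projected gradient step.\<close>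

lemma
  shows opt_in_H: "opt \<xi> \<in> H" and opt_first_order: "P (G (opt \<xi>) \<xi>) = 0"
proof -
  have "\<exists>!x. closest_point H (x - \<tau> *\<^sub>R G x \<xi>) = x"
    using \<rho>_bounds projected_step_norm_le by (intro banach_fix_type[of \<rho>]) (auto simp: dist_norm)
  then obtain x where x: "closest_point H (x - \<tau> *\<^sub>R G x \<xi>) = x" by blast
  then have xH: "x \<in> H" by (metis closest_point_H_in)
  have "P (\<tau> *\<^sub>R G x \<xi>) = 0"
    using closest_point_affine_minus[OF subspace_V H_def xH, of "\<tau> *\<^sub>R G x \<xi>"] x by simp
  then have PG: "P (G x \<xi>) = 0"
    using \<tau>_pos linear_scale[OF linear_closest_point_subspace[OF subspace_V]] by simp
  \<comment> \<open>Quadratic growth on \<open>H\<close> shows both that the fixed point is a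
    minimizer and that no other minimizer exists.\<close>
  have lower: "L (y, \<xi>) \<ge> L (x, \<xi>) + m / 2 * (norm (y - x))\<^sup>2" if "y \<in> H" for y
  proof -
    have "y - x \<in> V"
      using subspace_diff[OF subspace_V, of "y - p" "x - p"] that xH by (simp add: H_def)
    then have "G x \<xi> \<bullet> (y - x) = 0"
      using inner_closest_point_subspace[OF subspace_V, of "y - x" "G x \<xi>"] PG by simp
    then show ?thesis
      using strongly_convex_on_first_order[OF strongly_convex GDERIV_G, of x \<xi> y] by simp
  qed
  have "is_arg_min (\<lambda>\<eta>. L (\<eta>, \<xi>)) (\<lambda>x. x \<in> H) x"
    unfolding is_arg_min_def using xH lower m_pos
    by (smt (verit, best) mult_nonneg_nonneg divide_nonneg_nonneg zero_le_power2)
  \<comment> \<open>\<open>lower_solution\<close> is a Hilbert choice, so the witness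
    \<open>x\<close> is what makes it a genuine minimizer.\<close>
  then have "is_arg_min (\<lambda>\<eta>. L (\<eta>, \<xi>)) (\<lambda>x. x \<in> H) (opt \<xi>)"
    unfolding lower_solution_def arg_min_on_def arg_min_def by (rule someI)
  then have o: "opt \<xi> \<in> H" "L (opt \<xi>, \<xi>) \<le> L (x, \<xi>)"
    unfolding is_arg_min_def using xH by (auto simp: not_less)
  then have "m / 2 * (norm (opt \<xi> - x))\<^sup>2 \<le> 0"
    using lower[OF o(1)] by linarith
  then have "opt \<xi> = x"
    using m_pos by (simp add: mult_le_0_iff)
  then show "opt \<xi> \<in> H" "P (G (opt \<xi>) \<xi>) = 0"
    using o PG by auto
qed

section \<open>Lipschitz continuity of the solution map\<close>

lemma opt_fixed: "closest_point H (opt \<xi> - \<tau> *\<^sub>R G (opt \<xi>) \<xi>) = opt \<xi>"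
  using closest_point_affine_minus[OF subspace_V H_def opt_in_H] opt_first_order
    linear_scale[OF linear_closest_point_subspace[OF subspace_V]] by simp

lemma inner_G_opt: "v \<in> V \<Longrightarrow> G (opt \<xi>) \<xi> \<bullet> v = 0"
  using inner_closest_point_subspace[OF subspace_V, of v "G (opt \<xi>) \<xi>"] opt_first_order by simp

lemma opt_diff_in_V: "opt \<xi> - opt \<zeta> \<in> V"
  using subspace_diff[OF subspace_V, of "opt \<xi> - p" "opt \<zeta> - p"] opt_in_H by (simp add: H_def)

lemma opt_lipschitz: "norm (opt \<xi> - opt \<zeta>) \<le> L_eta l1 m * norm (\<xi> - \<zeta>)"
proof -
  let ?d = "opt \<xi> - opt \<zeta>"
  have "m * (norm ?d)\<^sup>2 \<le> (G (opt \<xi>) \<xi> - G (opt \<zeta>) \<xi>) \<bullet> ?d"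
    by (rule G_monotone)
  \<comment> \<open>Both optimal gradients are orthogonal to \<open>?d\<close>, so one may replace
    the other; the remaining difference varies only in the \<xi> argument.\<close>
  also have "\<dots> = (G (opt \<zeta>) \<zeta> - G (opt \<zeta>) \<xi>) \<bullet> ?d"
    using inner_G_opt[OF opt_diff_in_V] by (simp add: inner_diff_left)
  also have "\<dots> \<le> norm (G (opt \<zeta>) \<zeta> - G (opt \<zeta>) \<xi>) * norm ?d"
    by (rule norm_cauchy_schwarz)
  also have "\<dots> \<le> (l1 * norm (\<zeta> - \<xi>)) * norm ?d"
    by (intro mult_right_mono G_lipschitz_snd) auto
  finally have "norm ?d * (m * norm ?d) \<le> norm ?d * (l1 * norm (\<xi> - \<zeta>))"
    by (simp add: power2_eq_square norm_minus_commute mult_ac)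
  then have "m * norm ?d \<le> l1 * norm (\<xi> - \<zeta>)"
    using l1_pos by (cases "norm ?d = 0") (auto simp: mult_le_cancel_left)
  then show ?thesis
    using m_pos by (simp add: L_eta_def field_simps)
qed

lemma L_eta_ge_1: "L_eta l1 m \<ge> 1"
  using m_le_l1 m_pos by (simp add: L_eta_def)

section \<open>Second derivatives and the sensitivity equation\<close>

lemma has_derivative_M: "((\<lambda>z. fst (gradient L z)) has_derivative M z) (at z)"
  unfolding M_def by (intro has_derivative_fst has_derivative_gradient grad_differentiable)

lemma linear_M: "linear (M z)"
  using has_derivative_M has_derivative_linear by blast

lemma M_add: "M z (h + k) = M z h + M z k" and M_diff: "M z (h - k) = M z h - M z k"
  by (simp_all add: linear_add linear_diff linear_M)

lemma has_derivative_G_fst: "((\<lambda>x. G x \<xi>) has_derivative (\<lambda>v. M (x, \<xi>) (v, 0))) (at x)"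
proof -
  have "((\<lambda>x. (x, \<xi>)) has_derivative (\<lambda>h. (h, 0))) (at x)"
    by (auto intro!: derivative_eq_intros)
  from diff_chain_at[OF this has_derivative_M] show ?thesis
    by (simp add: o_def G_def)
qed

lemma has_derivative_G_snd: "((\<lambda>\<xi>. G x \<xi>) has_derivative (\<lambda>h. M (x, \<xi>) (0, h))) (at \<xi>)"
proof -
  have "((\<lambda>\<xi>. (x, \<xi>)) has_derivative (\<lambda>h. (0, h))) (at \<xi>)"
    by (auto intro!: derivative_eq_intros)
  from diff_chain_at[OF this has_derivative_M] show ?thesis
    by (simp add: o_def G_def)
qed

lemma M_coercive: "m * (norm v)\<^sup>2 \<le> M z (v, 0) \<bullet> v"
  using has_derivative_coercive[OF has_derivative_G_fst[where \<xi> = "snd z" and x = "fst z"] G_monotone, of v] by simp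

lemma M_step_norm_le: "norm (v - \<tau> *\<^sub>R M z (v, 0)) \<le> \<rho> * norm v"
proof (rule has_derivative_norm_le[where f = "\<lambda>x. x - \<tau> *\<^sub>R G x (snd z)" and x = "fst z"])
  show "((\<lambda>x. x - \<tau> *\<^sub>R G x (snd z)) has_derivative (\<lambda>v. v - \<tau> *\<^sub>R M z (v, 0))) (at (fst z))"
    using has_derivative_G_fst[where \<xi> = "snd z" and x = "fst z"] by (auto intro!: derivative_eq_intros)
qed (rule gradient_step_norm_le)

lemma M_snd_norm_le: "norm (M z (0, h)) \<le> l1 * norm h"
  using has_derivative_norm_le[OF has_derivative_G_snd[where \<xi> = "snd z" and x = "fst z"] G_lipschitz_snd, of h] by simp

lemma M_lipschitz: "norm (M z h - M z' h) \<le> l2 * norm (z - z') * norm h"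
proof -
  have "M z h - M z' h = fst ((hessian L z - hessian L z') h)"
    by (simp add: M_def blinfun.diff_left)
  also have "norm \<dots> \<le> norm ((hessian L z - hessian L z') h)"
    by (rule norm_fst_le_norm)
  also have "\<dots> \<le> norm (hessian L z - hessian L z') * norm h"
    by (rule norm_blinfun)
  also have "\<dots> \<le> l2 * norm (z - z') * norm h"
    by (intro mult_right_mono hessian_lipschitz_norm) auto
  finally show ?thesis .
qed

text \<open>The conditions on \<open>J\<close> are the first-order condition for \<open>opt\<close>, differentiated in \<open>\<xi>\<close>.\<close>

lemma sensitivity_exists:
  "\<exists>J. linear J \<and> (\<forall>h. J h \<in> V \<and> (\<forall>v\<in>V. M z (J h, h) \<bullet> v = 0))"
proof -
  note P = linear_closest_point_subspace[OF subspace_V]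
  note PV = closest_point_in_subspace[OF subspace_V]
  \<comment> \<open>The equation lives on \<open>V\<close>. \<open>T\<close> extends its operator by
    the identity on the orthogonal complement, so that injectivity, which follows from coercivity,
    gives an inverse on the whole space.\<close>
  define T where "T v = P (M z (P v, 0)) + (v - P v)" for v
  have "linear (\<lambda>v. M z (v, 0))"
    using has_derivative_linear[OF has_derivative_G_fst[where \<xi> = "snd z" and x = "fst z"]] by simp
  then have linT: "linear T"
    unfolding T_def using P
    by (intro linear_compose_add linear_compose_sub linear_id[unfolded id_def])
       (auto intro: linear_compose[unfolded o_def])
  have T_inner: "T v \<bullet> w = M z (P v, 0) \<bullet> w" if "w \<in> V" for v w
    using inner_closest_point_subspace[OF subspace_V that]
    by (simp add: T_def inner_add_left inner_diff_left)
  have "v = 0" if "T v = 0" for v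
  proof -
    have "M z (P v, 0) \<bullet> P v = 0"
      using T_inner[OF PV, of v v] that by simp
    then have "m * (norm (P v))\<^sup>2 \<le> 0"
      using M_coercive[of "P v" z] by simp
    then have "P v = 0"
      using m_pos by (simp add: mult_le_0_iff)
    then show "v = 0"
      using that linear_M[of z] P by (simp add: T_def linear_0 zero_prod_def[symmetric])
  qed
  then have "inj T"
    using linT by (simp add: linear_injective_0)
  then obtain T' where T': "linear T'" "\<And>x. T (T' x) = x"
    using linear_injective_isomorphism[OF linT] by blast
  have linN: "linear (\<lambda>h. M z (0, h))"
    using has_derivative_linear[OF has_derivative_G_snd[where \<xi> = "snd z" and x = "fst z"]] by simp
  define J where "J h = T' (- P (M z (0, h)))" for h
  have linJ: "linear J"
    unfolding J_def
    using linear_compose[OF linear_compose[OF linear_compose[OF linN P] linear_uminus] T'(1)]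
    by (simp add: o_def)
  have TJ: "T (J h) = - P (M z (0, h))" for h
    by (simp add: J_def T')
  \<comment> \<open>\<open>T\<close> keeps the component orthogonal to \<open>V\<close>, and
    \<open>T (J h)\<close> lies in \<open>V\<close>; hence so does \<open>J h\<close>.\<close>
  have JV: "J h \<in> V" for h
  proof -
    have "J h = P (J h) + (- P (M z (0, h)) - P (M z (P (J h), 0)))"
      using TJ[of h] by (simp add: T_def algebra_simps)
    also have "\<dots> \<in> V"
      by (intro subspace_add subspace_diff subspace_neg subspace_V PV)
    finally show ?thesis .
  qed
  have PJ: "P (J h) = J h" for h
    using JV by (rule closest_point_self)
  have "M z (J h, h) \<bullet> v = 0" if "v \<in> V" for h v
  proof -
    have "M z (J h, h) = M z (J h, 0) + M z (0, h)"
      using M_add[of z "(J h, 0)" "(0, h)"] by simp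
    moreover have "M z (J h, 0) \<bullet> v = - (M z (0, h) \<bullet> v)"
      using T_inner[OF that, of "J h"] TJ[of h] inner_closest_point_subspace[OF subspace_V that] PJ
      by simp
    ultimately show ?thesis by (simp add: inner_add_left)
  qed
  with linJ JV show ?thesis by blast
qed

text \<open>The candidate for the derivative of \<open>opt\<close>, confirmed by
  \<open>has_derivative_opt\<close>.\<close>

definition Dopt :: "'b \<Rightarrow> 'b \<Rightarrow> 'a" where
  "Dopt \<xi> = (SOME J. linear J \<and> (\<forall>h. J h \<in> V \<and> (\<forall>v\<in>V. M (opt \<xi>, \<xi>) (J h, h) \<bullet> v = 0)))"

lemma
  shows linear_Dopt: "linear (Dopt \<xi>)" and Dopt_in_V: "Dopt \<xi> h \<in> V"
    and Dopt_equation: "v \<in> V \<Longrightarrow> M (opt \<xi>, \<xi>) (Dopt \<xi> h, h) \<bullet> v = 0"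
  using someI_ex[OF sensitivity_exists[of "(opt \<xi>, \<xi>)"]] unfolding Dopt_def by blast+

text \<open>The energy estimate for a coercive linear equation with right-hand side
  \<open>- r\<close>. It yields the bound on \<open>Dopt\<close>, its Lipschitz continuity and the
  differentiability of \<open>opt\<close>, with a different \<open>r\<close> each time.\<close>

lemma coercive_norm_le:
  assumes "m * (norm w)\<^sup>2 \<le> - (r \<bullet> w)"
  shows "norm w \<le> norm r / m"
proof -
  have "m * (norm w)\<^sup>2 \<le> norm r * norm w"
    using assms norm_cauchy_schwarz[of "- r" w] by simp
  then have "norm w * (m * norm w) \<le> norm w * norm r"
    by (simp add: power2_eq_square mult_ac)
  then have "m * norm w \<le> norm r"
    by (cases "norm w = 0") (auto simp: mult_le_cancel_left)
  then show ?thesis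
    using m_pos by (simp add: field_simps)
qed

lemma Dopt_norm_le: "norm (Dopt \<xi> h) \<le> L_eta l1 m * norm h"
proof -
  let ?z = "(opt \<xi>, \<xi>)"
  have "M ?z (Dopt \<xi> h, 0) \<bullet> Dopt \<xi> h = - (M ?z (0, h) \<bullet> Dopt \<xi> h)"
    using Dopt_equation[OF Dopt_in_V, of \<xi> h \<xi> h] M_add[of ?z "(Dopt \<xi> h, 0)" "(0, h)"]
    by (simp add: inner_add_left)
  then have "norm (Dopt \<xi> h) \<le> norm (M ?z (0, h)) / m"
    using M_coercive[of "Dopt \<xi> h" ?z] by (intro coercive_norm_le) simp
  also have "\<dots> \<le> l1 * norm h / m"
    using m_pos by (intro divide_right_mono M_snd_norm_le) auto
  finally show ?thesis by (simp add: L_eta_def)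
qed

lemma norm_Dopt_Pair_le: "norm (Dopt \<xi> h, h) \<le> (1 + L_eta l1 m) * norm h"
  using norm_Pair_le[of "Dopt \<xi> h" h] Dopt_norm_le[of \<xi> h] by (simp add: algebra_simps)

lemma norm_opt_Pair_diff_le:
  "norm ((opt \<xi>, \<xi>) - (opt \<zeta>, \<zeta>)) \<le> (1 + L_eta l1 m) * norm (\<xi> - \<zeta>)"
  using norm_Pair_le[of "opt \<xi> - opt \<zeta>" "\<xi> - \<zeta>"] opt_lipschitz[of \<xi> \<zeta>]
  by (simp add: algebra_simps)

text \<open>The difference of two sensitivities solves the equation at the first point, with the
  change of the Hessian as right-hand side. One factor \<open>1 + L_eta l1 m\<close> comes from the
  displacement of the point \<open>(opt \<xi>, \<xi>)\<close>, the other from the direction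
  \<open>(Dopt \<zeta> h, h)\<close>.\<close>

lemma Dopt_lipschitz: "norm (Dopt \<xi> h - Dopt \<zeta> h) \<le> L_eta_xi l1 l2 m * norm (\<xi> - \<zeta>) * norm h"
proof -
  let ?z = "(opt \<xi>, \<xi>)" and ?z' = "(opt \<zeta>, \<zeta>)"
  let ?w = "Dopt \<xi> h - Dopt \<zeta> h"
  define r where "r = M ?z (Dopt \<zeta> h, h) - M ?z' (Dopt \<zeta> h, h)"
  have wV: "?w \<in> V" by (intro subspace_diff subspace_V Dopt_in_V)
  have "M ?z (?w, 0) = M ?z (Dopt \<xi> h, h) - M ?z (Dopt \<zeta> h, h)"
    using M_diff[of ?z "(Dopt \<xi> h, h)" "(Dopt \<zeta> h, h)"] by simp
  then have "M ?z (?w, 0) \<bullet> ?w = - (r \<bullet> ?w)"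
    using Dopt_equation[OF wV] by (simp add: r_def inner_diff_left)
  then have "norm ?w \<le> norm r / m"
    using M_coercive[of ?w ?z] by (intro coercive_norm_le) simp
  also have "norm r \<le> l2 * norm (?z - ?z') * norm (Dopt \<zeta> h, h)"
    unfolding r_def by (rule M_lipschitz)
  also have "\<dots> \<le> l2 * ((1 + L_eta l1 m) * norm (\<xi> - \<zeta>)) * ((1 + L_eta l1 m) * norm h)"
    using l2_nonneg L_eta_ge_1
    by (intro mult_mono norm_opt_Pair_diff_le norm_Dopt_Pair_le mult_left_mono mult_nonneg_nonneg) auto
  finally have "norm ?w \<le> l2 * ((1 + L_eta l1 m) * norm (\<xi> - \<zeta>)) * ((1 + L_eta l1 m) * norm h) / m"
    using m_pos by (simp add: divide_right_mono)
  then show ?thesis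
    by (simp add: L_eta_xi_def L_eta_def[of l1] power2_eq_square mult_ac)
qed

text \<open>The linearization error of \<open>opt\<close> solves a coercive equation whose
  right-hand side is the Taylor remainder of the gradient. Lipschitz continuity of
  \<open>opt\<close> bounds that remainder by a multiple of the change in \<xi>.\<close>

lemma has_derivative_opt: "(opt has_derivative Dopt \<xi>) (at \<xi>)"
  unfolding has_derivative_at_alt
proof (intro conjI allI impI)
  show "bounded_linear (Dopt \<xi>)"
    using linear_Dopt by (simp add: linear_conv_bounded_linear)
  fix e :: real assume e: "e > 0"
  let ?z = "(opt \<xi>, \<xi>)" and ?c = "1 + L_eta l1 m"
  have c: "?c > 0" using L_eta_ge_1 by simp
  \<comment> \<open>The tolerance anticipates the loss of \<open>1 / m\<close> in
    \<open>coercive_norm_le\<close> and of \<open>?c\<close> in passing from \<xi> to the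
    pair.\<close>
  have e': "e * m / ?c > 0" using e m_pos c by simp
  obtain d where d: "d > 0" and grad: "\<And>z. norm (z - ?z) < d \<Longrightarrow>
      norm (fst (gradient L z) - fst (gradient L ?z) - M ?z (z - ?z)) \<le> e * m / ?c * norm (z - ?z)"
    using has_derivative_M[of ?z] e' unfolding has_derivative_at_alt by blast
  have "norm (opt \<zeta> - opt \<xi> - Dopt \<xi> (\<zeta> - \<xi>)) \<le> e * norm (\<zeta> - \<xi>)"
    if \<zeta>: "norm (\<zeta> - \<xi>) < d / ?c" for \<zeta>
  proof -
    let ?z' = "(opt \<zeta>, \<zeta>)" and ?h = "\<zeta> - \<xi>"
    let ?w = "opt \<zeta> - opt \<xi> - Dopt \<xi> ?h"
    define r where "r = fst (gradient L ?z') - fst (gradient L ?z) - M ?z (?z' - ?z)"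
    have nz: "norm (?z' - ?z) \<le> ?c * norm ?h"
      by (rule norm_opt_Pair_diff_le)
    also have "\<dots> < d" using \<zeta> c by (simp add: field_simps)
    finally have "norm r \<le> e * m / ?c * norm (?z' - ?z)"
      unfolding r_def by (rule grad)
    also have "\<dots> \<le> e * m / ?c * (?c * norm ?h)"
      using nz e' by (intro mult_left_mono) auto
    finally have r: "norm r \<le> e * m * norm ?h"
      using c by simp
    have wV: "?w \<in> V"
      by (intro subspace_diff[OF subspace_V] opt_diff_in_V Dopt_in_V)
    have "M ?z (?w, 0) = M ?z (?z' - ?z) - M ?z (Dopt \<xi> ?h, ?h)"
      using M_diff[of ?z "?z' - ?z" "(Dopt \<xi> ?h, ?h)"] by simp
    \<comment> \<open>Against a vector of \<open>V\<close> both gradient values vanish by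
      optimality, and only the linear term of \<open>r\<close> survives.\<close>
    moreover have "r \<bullet> ?w = - (M ?z (?z' - ?z) \<bullet> ?w)"
      using inner_G_opt[OF wV, of \<zeta>] inner_G_opt[OF wV, of \<xi>]
      unfolding r_def G_def by (simp only: inner_diff_left)
    ultimately have "M ?z (?w, 0) \<bullet> ?w = - (r \<bullet> ?w)"
      using Dopt_equation[OF wV, of \<xi> ?h] by (simp only: inner_diff_left)
    then have "norm ?w \<le> norm r / m"
      using M_coercive[of ?w ?z] by (intro coercive_norm_le) simp
    also have "\<dots> \<le> e * norm ?h"
      using r m_pos by (simp add: field_simps)
    finally show ?thesis .
  qed
  then show "\<exists>d>0. \<forall>y. norm (y - \<xi>) < d \<longrightarrow> norm (opt y - opt \<xi> - Dopt \<xi> (y - \<xi>)) \<le> e * norm (y - \<xi>)"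
    using d c by (intro exI[of _ "d / ?c"]) auto
qed

end

section \<open>The bilevel objective\<close>

text \<open>Take \<open>h = g\<close>. Gradients are known here only through their inner products,
  so their norms are bounded by duality.\<close>

lemma norm_le_if_inner_le:
  assumes "c \<ge> 0" "\<And>h. h \<bullet> g \<le> c * norm h"
  shows "norm g \<le> c"
proof -
  have "norm g * norm g \<le> c * norm g"
    using assms(2)[of g] by (simp add: power2_norm_eq_inner flip: power2_eq_square)
  then show ?thesis
    using assms(1) by (cases "norm g = 0") (auto simp: mult_le_cancel_right)
qed

lemma norm_gradient_le_lipschitz:
  fixes f :: "'a::euclidean_space \<Rightarrow> real"
  assumes "f differentiable (at x)" "l-lipschitz_on UNIV f"
  shows "norm (gradient f x) \<le> l"
proof (rule norm_le_if_inner_le)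
  show "l \<ge> 0" using assms(2) by (rule lipschitz_on_nonneg)
  have "norm (f y - f x) \<le> l * norm (y - x)" for y
    using lipschitz_onD[OF assms(2), of y x] by (simp add: dist_norm)
  from has_derivative_norm_le[OF GDERIV_gradient[OF assms(1), unfolded gderiv_def] this]
  show "h \<bullet> gradient f x \<le> l * norm h" for h
    by (metis abs_le_D1 real_norm_def)
qed

locale smooth_bilevel = strongly_convex_lower_level V H p L l1 l2 m \<tau>
  for V H :: "'a::euclidean_space set" and p L l1 l2 m \<tau> +
  fixes W \<Xi> :: "'b::euclidean_space set" and q :: 'b
    and U :: "'a \<times> 'b \<Rightarrow> real" and u0 u1 :: real
  assumes subspace_W: "subspace W" and \<Xi>_def: "\<Xi> = {x. x - q \<in> W}"
    and U_differentiable: "\<And>z. U differentiable (at z)"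
    and U_lipschitz: "u0-lipschitz_on UNIV U"
    and grad_U_lipschitz: "u1-lipschitz_on UNIV (gradient U)"
begin

abbreviation u :: "'b \<Rightarrow> real" where "u \<equiv> bilevel_objective H U L"

abbreviation lip\<eta> :: real where "lip\<eta> \<equiv> L_eta l1 m"

abbreviation lipu :: real where "lipu \<equiv> L_u u0 u1 l1 l2 m"

lemma u0_nonneg: "u0 \<ge> 0" and u1_nonneg: "u1 \<ge> 0"
  using U_lipschitz grad_U_lipschitz lipschitz_on_nonneg by blast+

lemma norm_gradient_U: "norm (gradient U z) \<le> u0"
  using norm_gradient_le_lipschitz U_differentiable U_lipschitz by blast

lemma gradient_U_lipschitz_norm: "norm (gradient U z - gradient U z') \<le> u1 * norm (z - z')"
  using lipschitz_onD[OF grad_U_lipschitz, of z z'] by (simp add: dist_norm)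

lemma has_derivative_u:
  "(u has_derivative (\<lambda>h. (Dopt \<xi> h, h) \<bullet> gradient U (opt \<xi>, \<xi>))) (at \<xi>)"
proof -
  have U: "(U has_derivative (\<lambda>h. h \<bullet> gradient U (opt \<xi>, \<xi>))) (at (opt \<xi>, \<xi>))"
    using GDERIV_gradient[OF U_differentiable] by (simp add: gderiv_def)
  have "((\<lambda>\<xi>. (opt \<xi>, \<xi>)) has_derivative (\<lambda>h. (Dopt \<xi> h, h))) (at \<xi>)"
    by (intro has_derivative_Pair has_derivative_opt has_derivative_ident)
  from diff_chain_at[OF this U] show ?thesis
    by (simp add: o_def bilevel_objective_def[abs_def])
qed

lemma GDERIV_u: "GDERIV u \<xi> :> gradient u \<xi>"
  using has_derivative_u by (intro GDERIV_gradient) (auto simp: differentiable_def)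

lemma inner_gradient_u: "h \<bullet> gradient u \<xi> = (Dopt \<xi> h, h) \<bullet> gradient U (opt \<xi>, \<xi>)"
  using has_derivative_unique[OF GDERIV_u[unfolded gderiv_def] has_derivative_u] by metis

text \<open>Bounds the objective after the first upper-level step by its value at the start,
  uniformly in the step size.\<close>

lemma u_lipschitz: "\<bar>u \<xi> - u \<zeta>\<bar> \<le> u0 * ((1 + lip\<eta>) * norm (\<xi> - \<zeta>))"
proof -
  have "\<bar>u \<xi> - u \<zeta>\<bar> \<le> u0 * norm ((opt \<xi>, \<xi>) - (opt \<zeta>, \<zeta>))"
    using lipschitz_onD[OF U_lipschitz, of "(opt \<xi>, \<xi>)" "(opt \<zeta>, \<zeta>)"]
    by (simp add: bilevel_objective_def dist_norm)
  also have "\<dots> \<le> u0 * ((1 + lip\<eta>) * norm (\<xi> - \<zeta>))"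
    by (intro mult_left_mono norm_opt_Pair_diff_le u0_nonneg)
  finally show ?thesis .
qed

lemma L_u_nonneg: "lipu \<ge> 0"
  using u0_nonneg u1_nonneg l2_nonneg m_pos by (simp add: L_u_def L_eta_xi_def)

text \<open>The two summands of \<open>L_u\<close> are the two terms of a product rule: the gradient
  of \<open>U\<close> changes at fixed sensitivity, then the sensitivity changes at fixed
  gradient.\<close>

lemma gradient_u_lipschitz: "norm (gradient u \<xi> - gradient u \<zeta>) \<le> lipu * norm (\<xi> - \<zeta>)"
proof (rule norm_le_if_inner_le)
  show "0 \<le> lipu * norm (\<xi> - \<zeta>)"
    using L_u_nonneg by simp
  fix h
  let ?g = "gradient U (opt \<xi>, \<xi>)" and ?g' = "gradient U (opt \<zeta>, \<zeta>)"
  have "h \<bullet> (gradient u \<xi> - gradient u \<zeta>) = (Dopt \<xi> h, h) \<bullet> ?g - (Dopt \<zeta> h, h) \<bullet> ?g'"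
    by (simp only: inner_diff_right inner_gradient_u)
  also have "\<dots> = (Dopt \<xi> h, h) \<bullet> (?g - ?g') + (Dopt \<xi> h - Dopt \<zeta> h, 0) \<bullet> ?g'"
    by (simp add: inner_diff_right inner_diff_left inner_prod_def)
  also have "\<dots> \<le> norm (Dopt \<xi> h, h) * norm (?g - ?g') + norm (Dopt \<xi> h - Dopt \<zeta> h, 0 :: 'b) * norm ?g'"
    by (intro add_mono norm_cauchy_schwarz)
  also have "\<dots> \<le> ((1 + lip\<eta>) * norm h) * (u1 * ((1 + lip\<eta>) * norm (\<xi> - \<zeta>)))
      + (L_eta_xi l1 l2 m * norm (\<xi> - \<zeta>) * norm h) * u0"
  proof (intro add_mono mult_mono norm_Dopt_Pair_le norm_gradient_U)
    show "norm (?g - ?g') \<le> u1 * ((1 + lip\<eta>) * norm (\<xi> - \<zeta>))"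
      using gradient_U_lipschitz_norm norm_opt_Pair_diff_le u1_nonneg
      by (meson mult_left_mono order_trans)
    show "norm (Dopt \<xi> h - Dopt \<zeta> h, 0 :: 'b) \<le> L_eta_xi l1 l2 m * norm (\<xi> - \<zeta>) * norm h"
      using Dopt_lipschitz by (simp add: norm_Pair)
  qed (use L_eta_ge_1 l2_nonneg m_pos in \<open>auto simp: L_eta_xi_def\<close>)
  also have "\<dots> = lipu * norm (\<xi> - \<zeta>) * norm h"
    by (simp add: L_u_def power2_eq_square algebra_simps)
  finally show "h \<bullet> (gradient u \<xi> - gradient u \<zeta>) \<le> lipu * norm (\<xi> - \<zeta>) * norm h" .
qed

section \<open>Accuracy of the unrolled hypergradient\<close>

text \<open>The midpoint of \<open>\<rho>\<close> and 1; the gap \<open>\<tau> * m / 4\<close> to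
  \<open>\<rho>\<close> absorbs the perturbation in the Jacobian recursion.\<close>

definition \<sigma> :: real where "\<sigma> = 1 - \<tau> * m / 4"

lemma \<sigma>_bounds: "0 < \<sigma>" "\<sigma> < 1" "\<rho> \<le> \<sigma>"
  using \<tau>_m unfolding \<rho>_def \<sigma>_def by auto

lemma P_add: "P (x + y) = P x + P y" and P_diff: "P (x - y) = P x - P y"
  and P_scale: "P (r *\<^sub>R x) = r *\<^sub>R P x"
  using linear_closest_point_subspace[OF subspace_V] linear_add linear_diff linear_scale by blast+

lemma norm_P_le: "norm (P x) \<le> norm x"
  by (rule norm_closest_point_subspace_le[OF subspace_V])

text \<open>\<open>X\<close> stands for the inner iterates and \<open>Z s h\<close> for the unrolled
  Jacobian applied to the direction \<open>h\<close>.\<close>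

context
  fixes X :: "nat \<Rightarrow> 'a" and Z :: "nat \<Rightarrow> 'b \<Rightarrow> 'a" and \<xi> :: 'b
  assumes X_Suc: "\<And>s. X (Suc s) = closest_point H (X s - \<tau> *\<^sub>R G (X s) \<xi>)"
    and Z_0: "\<And>h. Z 0 h = 0"
    and Z_Suc: "\<And>s h. Z (Suc s) h = P (Z s h - \<tau> *\<^sub>R M (X s, \<xi>) (Z s h, h))"
begin

lemma inner_loop_error: "norm (X s - opt \<xi>) \<le> \<rho> ^ s * norm (X 0 - opt \<xi>)"
proof (induction s)
  case (Suc s)
  have "norm (X (Suc s) - opt \<xi>) \<le> \<rho> * norm (X s - opt \<xi>)"
    using projected_step_norm_le[of "X s" \<xi> "opt \<xi>"] by (simp add: X_Suc opt_fixed)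
  also have "\<dots> \<le> \<rho> * (\<rho> ^ s * norm (X 0 - opt \<xi>))"
    using \<rho>_bounds Suc by (intro mult_left_mono) auto
  finally show ?case by simp
qed simp

text \<open>The constant \<open>2 * lip\<eta>\<close> is the fixed point of
  \<open>c = \<rho> * c + \<tau> * l1\<close>, because
  \<open>1 - \<rho> = \<tau> * m / 2\<close>.\<close>

lemma unrolled_jacobian_bounded: "norm (Z s h) \<le> 2 * lip\<eta> * norm h"
proof (induction s)
  case 0
  then show ?case using Z_0 L_eta_ge_1 by simp
next
  case (Suc s)
  let ?z = "(X s, \<xi>)"
  have "Z (Suc s) h = P ((Z s h - \<tau> *\<^sub>R M ?z (Z s h, 0)) - \<tau> *\<^sub>R M ?z (0, h))"
    using M_add[of ?z "(Z s h, 0)" "(0, h)"] by (simp add: Z_Suc algebra_simps)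
  also have "norm \<dots> \<le> norm (Z s h - \<tau> *\<^sub>R M ?z (Z s h, 0)) + norm (\<tau> *\<^sub>R M ?z (0, h))"
    using norm_P_le norm_triangle_ineq4 order_trans by blast
  also have "\<dots> \<le> \<rho> * (2 * lip\<eta> * norm h) + \<tau> * (l1 * norm h)"
  proof (rule add_mono)
    show "norm (Z s h - \<tau> *\<^sub>R M ?z (Z s h, 0)) \<le> \<rho> * (2 * lip\<eta> * norm h)"
      using M_step_norm_le[of "Z s h" ?z] Suc \<rho>_bounds
      by (meson mult_left_mono less_imp_le order_trans)
    show "norm (\<tau> *\<^sub>R M ?z (0, h)) \<le> \<tau> * (l1 * norm h)"
      using M_snd_norm_le \<tau>_pos by simp
  qed
  also have "\<tau> * (l1 * norm h) = \<tau> * m * lip\<eta> * norm h"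
    using m_pos by (simp add: L_eta_def)
  also have "\<rho> * (2 * lip\<eta> * norm h) + \<dots> = 2 * lip\<eta> * norm h"
    by (simp add: \<rho>_def algebra_simps)
  finally show ?case .
qed

text \<open>The exact sensitivity is a fixed point of the unrolled recursion frozen at \<open>opt \<xi>\<close>; running
  it at \<open>X s\<close> instead adds a perturbation of order \<open>\<rho> ^ s\<close>, and \<open>s * \<rho> ^ s\<close> is absorbed by
  passing to the slower rate \<open>\<sigma>\<close>.\<close>

lemma unrolled_jacobian_error:
  assumes D: "norm (X 0 - opt \<xi>) \<le> D"
  shows "norm (Z s h - Dopt \<xi> h) \<le> (lip\<eta> + 4 * l2 * (1 + lip\<eta>) * D / m) * \<sigma> ^ s * norm h"
proof (induction s)
  case 0
  have "0 \<le> 4 * l2 * (1 + lip\<eta>) * D / m"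
    using l2_nonneg L_eta_ge_1 m_pos D norm_ge_zero[of "X 0 - opt \<xi>"]
    by (intro divide_nonneg_pos mult_nonneg_nonneg) linarith+
  then have "lip\<eta> * norm h \<le> (lip\<eta> + 4 * l2 * (1 + lip\<eta>) * D / m) * norm h"
    by (intro mult_right_mono) auto
  then show ?case
    using Dopt_norm_le[of \<xi> h] by (simp add: Z_0)
next
  case (Suc s)
  let ?z = "(X s, \<xi>)" and ?z' = "(opt \<xi>, \<xi>)"
  let ?J = "Dopt \<xi> h" and ?E = "Z s h - Dopt \<xi> h"
  \<comment> \<open>The first summand covers the initial error, as \<open>Z 0 h = 0\<close>. The
    second is scaled so that \<open>\<sigma> - \<rho>\<close> times it equals the coefficient of the
    perturbation.\<close>
  let ?C = "lip\<eta> + 4 * l2 * (1 + lip\<eta>) * D / m"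
  define r where "r = M ?z (?J, h) - M ?z' (?J, h)"
  have D0: "D \<ge> 0" using D norm_ge_zero order_trans by blast
  \<comment> \<open>This is the sensitivity equation; it makes \<open>?J\<close> a fixed point of
    the recursion frozen at the optimum.\<close>
  have "P (M ?z' (?J, h)) = 0"
    using Dopt_equation
    by (intro closest_point_subspace_eqI[OF subspace_V]) (auto simp: subspace_0 subspace_V)
  moreover have "P ?J = ?J"
    by (intro closest_point_self Dopt_in_V)
  moreover have "M ?z (Z s h, h) = M ?z (?E, 0) + M ?z (?J, h)"
    using M_add[of ?z "(?E, 0)" "(?J, h)"] by simp
  ultimately have "Z (Suc s) h - ?J = P (?E - \<tau> *\<^sub>R M ?z (?E, 0)) - \<tau> *\<^sub>R P r"
    by (simp add: Z_Suc r_def P_diff P_scale P_add algebra_simps)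
  also have "norm \<dots> \<le> norm (P (?E - \<tau> *\<^sub>R M ?z (?E, 0))) + norm (\<tau> *\<^sub>R P r)"
    by (rule norm_triangle_ineq4)
  also have "\<dots> \<le> \<rho> * (?C * \<sigma> ^ s * norm h) + \<tau> * (l2 * (\<sigma> ^ s * D) * ((1 + lip\<eta>) * norm h))"
  proof (rule add_mono)
    have "norm (P (?E - \<tau> *\<^sub>R M ?z (?E, 0))) \<le> \<rho> * norm ?E"
      using norm_P_le M_step_norm_le order_trans by blast
    also have "\<dots> \<le> \<rho> * (?C * \<sigma> ^ s * norm h)"
      using Suc \<rho>_bounds by (intro mult_left_mono) auto
    finally show "norm (P (?E - \<tau> *\<^sub>R M ?z (?E, 0))) \<le> \<rho> * (?C * \<sigma> ^ s * norm h)" .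
    have "norm (?z - ?z') \<le> \<rho> ^ s * norm (X 0 - opt \<xi>)"
      using inner_loop_error[of s] by (simp add: norm_Pair)
    also have "\<dots> \<le> \<sigma> ^ s * D"
      using \<rho>_bounds \<sigma>_bounds D by (intro mult_mono power_mono) auto
    finally have z: "norm (?z - ?z') \<le> \<sigma> ^ s * D" .
    have "norm (P r) \<le> norm r"
      by (rule norm_P_le)
    also have "\<dots> \<le> l2 * norm (?z - ?z') * norm (?J, h)"
      unfolding r_def by (rule M_lipschitz)
    also have "\<dots> \<le> l2 * (\<sigma> ^ s * D) * ((1 + lip\<eta>) * norm h)"
      using l2_nonneg z \<sigma>_bounds D0
      by (intro mult_mono norm_Dopt_Pair_le) auto
    finally show "norm (\<tau> *\<^sub>R P r) \<le> \<tau> * (l2 * (\<sigma> ^ s * D) * ((1 + lip\<eta>) * norm h))"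
      using \<tau>_pos by simp
  qed
  also have "\<dots> = (\<rho> * ?C + \<tau> * m / 4 * (4 * l2 * (1 + lip\<eta>) * D / m)) * (\<sigma> ^ s * norm h)"
  proof -
    have "\<tau> * m / 4 * (4 * l2 * (1 + lip\<eta>) * D / m) = \<tau> * (l2 * D * (1 + lip\<eta>))"
      using m_pos by (simp add: field_simps)
    then show ?thesis by (simp only:) (simp add: algebra_simps)
  qed
  also have "\<dots> \<le> (\<sigma> * ?C) * (\<sigma> ^ s * norm h)"
  proof (rule mult_right_mono)
    have "\<tau> * m * lip\<eta> \<ge> 0"
      using \<tau>_m L_eta_ge_1 by simp
    moreover have "\<sigma> * (a + b) = \<rho> * (a + b) + \<tau> * m / 4 * b + \<tau> * m * a / 4" for a b
      by (simp add: \<rho>_def \<sigma>_def algebra_simps)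
    then have "\<sigma> * ?C = \<rho> * ?C + \<tau> * m / 4 * (4 * l2 * (1 + lip\<eta>) * D / m) + \<tau> * m * lip\<eta> / 4" .
    ultimately show "\<rho> * ?C + \<tau> * m / 4 * (4 * l2 * (1 + lip\<eta>) * D / m) \<le> \<sigma> * ?C"
      by linarith
  qed (use \<sigma>_bounds in simp)
  finally show ?case by (simp add: mult_ac)
qed

context
  fixes g :: 'b and s :: nat
  assumes g: "\<And>h. h \<bullet> g = (Z s h, h) \<bullet> gradient U (X s, \<xi>)"
begin

text \<open>The bound ignores where the inner loop starts, so it limits the upper-level steps before
  anything is known about tracking.\<close>

lemma norm_hypergradient_le: "norm g \<le> u0 * (1 + 2 * lip\<eta>)"
proof (rule norm_le_if_inner_le)
  show "0 \<le> u0 * (1 + 2 * lip\<eta>)"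
    using u0_nonneg L_eta_ge_1 by simp
  fix h
  have "h \<bullet> g \<le> norm (Z s h, h) * norm (gradient U (X s, \<xi>))"
    unfolding g by (rule norm_cauchy_schwarz)
  also have "\<dots> \<le> (2 * lip\<eta> * norm h + norm h) * u0"
    using norm_Pair_le[of "Z s h" h] unrolled_jacobian_bounded[of s h] L_eta_ge_1
    by (intro mult_mono norm_gradient_U) auto
  finally show "h \<bullet> g \<le> u0 * (1 + 2 * lip\<eta>) * norm h"
    by (simp add: algebra_simps)
qed

text \<open>A product rule again: the error of the inner iterate enters through the gradient of
  \<open>U\<close>, that of the unrolled Jacobian through the direction. The faster rate
  \<open>\<rho>\<close> of the former is weakened to \<open>\<sigma>\<close>.\<close>

lemma hypergradient_error:
  assumes D: "norm (X 0 - opt \<xi>) \<le> D"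
  shows "norm (g - gradient u \<xi>)
    \<le> (u1 * D * (1 + lip\<eta>) + u0 * (lip\<eta> + 4 * l2 * (1 + lip\<eta>) * D / m)) * \<sigma> ^ s"
proof (rule norm_le_if_inner_le)
  let ?C = "lip\<eta> + 4 * l2 * (1 + lip\<eta>) * D / m"
  have D0: "D \<ge> 0" using D norm_ge_zero order_trans by blast
  then have C: "?C \<ge> 0"
    using l2_nonneg L_eta_ge_1 m_pos by simp
  show "0 \<le> (u1 * D * (1 + lip\<eta>) + u0 * ?C) * \<sigma> ^ s"
    using C D0 u0_nonneg u1_nonneg \<sigma>_bounds L_eta_ge_1
    by (intro mult_nonneg_nonneg add_nonneg_nonneg[of _ "u0 * _"]) auto
  fix h
  let ?g = "gradient U (X s, \<xi>)" and ?g' = "gradient U (opt \<xi>, \<xi>)"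
  have "norm (?g - ?g') \<le> u1 * norm ((X s, \<xi>) - (opt \<xi>, \<xi>))"
    by (rule gradient_U_lipschitz_norm)
  also have "\<dots> \<le> u1 * (\<rho> ^ s * norm (X 0 - opt \<xi>))"
    using inner_loop_error[of s] u1_nonneg by (intro mult_left_mono) (auto simp: norm_Pair)
  also have "\<dots> \<le> u1 * (\<sigma> ^ s * D)"
    using \<rho>_bounds \<sigma>_bounds D u1_nonneg by (intro mult_left_mono mult_mono power_mono) auto
  finally have gg: "norm (?g - ?g') \<le> u1 * (\<sigma> ^ s * D)" .
  have "h \<bullet> (g - gradient u \<xi>) = (Z s h, h) \<bullet> ?g - (Dopt \<xi> h, h) \<bullet> ?g'"
    by (simp only: inner_diff_right inner_gradient_u g)
  also have "\<dots> = (Dopt \<xi> h, h) \<bullet> (?g - ?g') + (Z s h - Dopt \<xi> h, 0) \<bullet> ?g"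
    by (simp add: inner_diff_right inner_diff_left inner_prod_def)
  also have "\<dots> \<le> norm (Dopt \<xi> h, h) * norm (?g - ?g') + norm (Z s h - Dopt \<xi> h, 0 :: 'b) * norm ?g"
    by (intro add_mono norm_cauchy_schwarz)
  also have "\<dots> \<le> ((1 + lip\<eta>) * norm h) * (u1 * (\<sigma> ^ s * D)) + (?C * \<sigma> ^ s * norm h) * u0"
    using unrolled_jacobian_error[OF D, of s h] gg L_eta_ge_1 C \<sigma>_bounds
    by (intro add_mono mult_mono norm_Dopt_Pair_le norm_gradient_U) (auto simp: norm_Pair)
  also have "\<dots> = (u1 * D * (1 + lip\<eta>) + u0 * ?C) * \<sigma> ^ s * norm h"
    by (simp add: algebra_simps)
  finally show "h \<bullet> (g - gradient u \<xi>) \<le> (u1 * D * (1 + lip\<eta>) + u0 * ?C) * \<sigma> ^ s * norm h" .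
qed

end

end

section \<open>The upper-level iteration\<close>

lemma stationarity_residual_eq:
  assumes "\<xi> \<in> \<Xi>"
  shows "stationarity_residual \<Xi> u \<xi> = (norm (closest_point W (gradient u \<xi>)))\<^sup>2"
  using closest_point_affine_minus[OF subspace_W \<Xi>_def assms]
  by (simp add: stationarity_residual_def)

lemma closest_point_\<Xi>_in: "closest_point \<Xi> x \<in> \<Xi>"
proof -
  have "q \<in> \<Xi>" using subspace_0[OF subspace_W] by (simp add: \<Xi>_def)
  from closest_point_affine[OF subspace_W \<Xi>_def this, of x] show ?thesis
    using closest_point_in_subspace[OF subspace_W] by (simp add: \<Xi>_def)
qed

lemma closest_point_\<Xi>_nonexpansive:
  "norm (closest_point \<Xi> x - closest_point \<Xi> y) \<le> norm (x - y)"
proof -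
  have "q \<in> \<Xi>" using subspace_0[OF subspace_W] by (simp add: \<Xi>_def)
  from closest_point_affine[OF subspace_W \<Xi>_def this] show ?thesis
    using linear_diff[OF linear_closest_point_subspace[OF subspace_W], of "x - q" "y - q"]
      norm_closest_point_subspace_le[OF subspace_W, of "x - y"] by simp
qed

text \<open>The smoothness inequality along the projected step \<open>a + d\<close>, where
  \<open>a\<close> is the projected exact gradient and \<open>d\<close> the projected hypergradient
  error.\<close>

lemma projected_descent:
  assumes \<xi>: "\<xi> \<in> \<Xi>" and t: "t > 0" "t * lipu \<le> 1 / 2"
    and g: "norm (g - gradient u \<xi>) \<le> \<delta>"
  shows "t / 2 * stationarity_residual \<Xi> u \<xi>
    \<le> u \<xi> - u (closest_point \<Xi> (\<xi> - t *\<^sub>R g)) + t / 2 * \<delta>\<^sup>2"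
proof -
  note lin = linear_closest_point_subspace[OF subspace_W]
  let ?Q = "closest_point W"
  define a where "a = ?Q (gradient u \<xi>)"
  define d where "d = ?Q (g - gradient u \<xi>)"
  have b: "?Q g = a + d"
    by (simp add: a_def d_def linear_diff[OF lin])
  have d: "(norm d)\<^sup>2 \<le> \<delta>\<^sup>2"
    using norm_closest_point_subspace_le[OF subspace_W, of "g - gradient u \<xi>"] g
    by (intro power_mono) (auto simp: d_def)
  have step: "closest_point \<Xi> (\<xi> - t *\<^sub>R g) = \<xi> - t *\<^sub>R (a + d)"
    using closest_point_affine_minus[OF subspace_W \<Xi>_def \<xi>] by (simp add: linear_scale[OF lin] b)
  have "u (\<xi> - t *\<^sub>R (a + d)) \<le> u \<xi> + gradient u \<xi> \<bullet> (- (t *\<^sub>R (a + d))) + lipu / 2 * (norm (t *\<^sub>R (a + d)))\<^sup>2"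
    using descent_lemma[OF GDERIV_u gradient_u_lipschitz, of "\<xi> - t *\<^sub>R (a + d)" \<xi>] by simp
  also have "gradient u \<xi> \<bullet> (- (t *\<^sub>R (a + d))) = - (t * (a \<bullet> (a + d)))"
    using inner_closest_point_subspace[OF subspace_W closest_point_in_subspace[OF subspace_W],
        of "gradient u \<xi>" g] by (simp add: b a_def)
  also have "lipu / 2 * (norm (t *\<^sub>R (a + d)))\<^sup>2 = (t * lipu) * (t / 2 * (norm (a + d))\<^sup>2)"
    using t by (simp add: power2_eq_square)
  also have "\<dots> \<le> 1 / 2 * (t / 2 * (norm (a + d))\<^sup>2)"
    using t by (intro mult_right_mono) auto
  finally have "u (\<xi> - t *\<^sub>R (a + d)) \<le> u \<xi> - t * (a \<bullet> (a + d) - (norm (a + d))\<^sup>2 / 4)"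
    by (simp add: algebra_simps)
  \<comment> \<open>Subtracting a further \<open>(norm (a + d))\<^sup>2 / 4\<close> from the left
    leaves exactly half the difference of the squared norms of \<open>a\<close> and
    \<open>d\<close>.\<close>
  moreover have "a \<bullet> (a + d) - (norm (a + d))\<^sup>2 / 4 \<ge> (norm a)\<^sup>2 / 2 - \<delta>\<^sup>2 / 2"
  proof -
    have "0 \<le> (norm (a + d))\<^sup>2" by simp
    then have "0 \<le> (norm a)\<^sup>2 + 2 * (a \<bullet> d) + (norm d)\<^sup>2"
      by (simp add: power2_norm_eq_inner inner_add inner_commute)
    moreover have "a \<bullet> (a + d) - (norm (a + d))\<^sup>2 / 4
        = 3 / 4 * (norm a)\<^sup>2 + (a \<bullet> d) / 2 - (norm d)\<^sup>2 / 4"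
      by (simp add: power2_norm_eq_inner inner_add inner_commute field_simps)
    ultimately show ?thesis using d by linarith
  qed
  then have "t * ((norm a)\<^sup>2 / 2 - \<delta>\<^sup>2 / 2) \<le> t * (a \<bullet> (a + d) - (norm (a + d))\<^sup>2 / 4)"
    using t by (intro mult_left_mono) auto
  ultimately show ?thesis
    unfolding step stationarity_residual_eq[OF \<xi>] a_def[symmetric]
    by (simp add: algebra_simps)
qed

text \<open>The starting point \<open>\<xi> 0\<close> may lie outside \<open>\<Xi>\<close>, so its residual is split off.\<close>

lemma sum_residual_le:
  assumes \<xi>_Suc: "\<And>k. \<xi> (Suc k) = closest_point \<Xi> (\<xi> k - t *\<^sub>R g k)"
    and t: "t > 0" "t * lipu \<le> 1 / 2"
    and g: "\<And>k. norm (g k - gradient u (\<xi> k)) \<le> \<delta>"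
    and lower: "\<And>x. x \<in> \<Xi> \<Longrightarrow> b \<le> u x"
  shows "(\<Sum>k<n. stationarity_residual \<Xi> u (\<xi> k))
    \<le> stationarity_residual \<Xi> u (\<xi> 0) + 2 / t * (u (\<xi> 1) - b) + real n * \<delta>\<^sup>2"
proof -
  have in_\<Xi>: "\<xi> (Suc k) \<in> \<Xi>" for k
    by (simp add: \<xi>_Suc closest_point_\<Xi>_in)
  have step: "stationarity_residual \<Xi> u (\<xi> (Suc k))
      \<le> 2 / t * (u (\<xi> (Suc k)) - u (\<xi> (Suc (Suc k)))) + \<delta>\<^sup>2" for k
  proof -
    have "2 / t * (t / 2 * stationarity_residual \<Xi> u (\<xi> (Suc k)))
        \<le> 2 / t * (u (\<xi> (Suc k)) - u (\<xi> (Suc (Suc k))) + t / 2 * \<delta>\<^sup>2)"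
      using projected_descent[OF in_\<Xi> t g, of k] t unfolding \<xi>_Suc[of "Suc k"]
      by (intro mult_left_mono) auto
    then show ?thesis using t by (simp add: distrib_left)
  qed
  \<comment> \<open>The telescope starts at index 1, the first iterate certain to lie in
    \<open>\<Xi>\<close>.\<close>
  have tele: "(\<Sum>k<n. stationarity_residual \<Xi> u (\<xi> (Suc k)))
      \<le> 2 / t * (u (\<xi> 1) - u (\<xi> (Suc n))) + real n * \<delta>\<^sup>2" for n
  proof (induction n)
    case (Suc n)
    then show ?case using step[of n] by (simp add: algebra_simps)
  qed simp
  show ?thesis
  proof (cases n)
    case 0
    have "2 / t * (u (\<xi> 1) - b) \<ge> 0"
      using lower[OF in_\<Xi>[of 0]] t by simp
    then show ?thesis
      using 0 by (simp add: stationarity_residual_def)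
  next
    case (Suc j)
    have "(\<Sum>k<n. stationarity_residual \<Xi> u (\<xi> k))
        \<le> stationarity_residual \<Xi> u (\<xi> 0) + (2 / t * (u (\<xi> 1) - u (\<xi> (Suc j))) + real j * \<delta>\<^sup>2)"
      unfolding Suc sum.lessThan_Suc_shift using tele[of j] by simp
    also have "2 / t * (u (\<xi> 1) - u (\<xi> (Suc j))) \<le> 2 / t * (u (\<xi> 1) - b)"
      using lower[OF in_\<Xi>[of j]] t by (intro mult_left_mono) auto
    also have "real j * \<delta>\<^sup>2 \<le> real n * \<delta>\<^sup>2"
      using Suc by (intro mult_right_mono) auto
    finally show ?thesis by simp
  qed
qed

text \<open>The second summand pays for an infeasible start; from the first step on, iterates are
  their own projections.\<close>

lemma upper_step_norm_le:
  assumes \<xi>_Suc: "\<And>k. \<xi> (Suc k) = closest_point \<Xi> (\<xi> k - t *\<^sub>R g k)"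
    and t: "0 \<le> t" "t \<le> T" and g: "\<And>k. norm (g k) \<le> c"
  shows "norm (\<xi> (Suc k) - \<xi> k) \<le> T * c + norm (closest_point \<Xi> (\<xi> 0) - \<xi> 0)"
proof -
  have "norm (\<xi> (Suc k) - closest_point \<Xi> (\<xi> k)) \<le> norm (t *\<^sub>R g k)"
    using closest_point_\<Xi>_nonexpansive[of "\<xi> k - t *\<^sub>R g k" "\<xi> k"] by (simp add: \<xi>_Suc)
  also have "\<dots> \<le> T * c"
    using t g[of k] by (auto intro!: mult_mono)
  finally have "norm (\<xi> (Suc k) - closest_point \<Xi> (\<xi> k)) \<le> T * c" .
  moreover have "norm (closest_point \<Xi> (\<xi> k) - \<xi> k) \<le> norm (closest_point \<Xi> (\<xi> 0) - \<xi> 0)"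
  proof (cases k)
    case (Suc j)
    have "closest_point \<Xi> (\<xi> k) = \<xi> k"
      unfolding Suc \<xi>_Suc by (rule closest_point_self[OF closest_point_\<Xi>_in])
    then show ?thesis by simp
  qed simp
  ultimately show ?thesis
    using norm_triangle_ineq[of "\<xi> (Suc k) - closest_point \<Xi> (\<xi> k)" "closest_point \<Xi> (\<xi> k) - \<xi> k"]
    by simp
qed

text \<open>Between inner loops the target \<open>opt (\<xi> k)\<close> drifts by at most
  \<open>lip\<eta> * R\<close>; the second summand \<open>r\<close> is the fixed point of
  \<open>r = \<rho> * r + lip\<eta> * R\<close>.\<close>

lemma tracking_error_bounded:
  assumes contr: "\<And>k. norm (\<eta> (Suc k) - opt (\<xi> k)) \<le> \<rho> * norm (\<eta> k - opt (\<xi> k))"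
    and R: "\<And>k. norm (\<xi> (Suc k) - \<xi> k) \<le> R"
  shows "norm (\<eta> k - opt (\<xi> k)) \<le> norm (\<eta> 0 - opt (\<xi> 0)) + lip\<eta> * R / (1 - \<rho>)"
proof -
  let ?e = "norm (\<eta> 0 - opt (\<xi> 0))" and ?r = "lip\<eta> * R / (1 - \<rho>)"
  have R0: "0 \<le> R" using R[of 0] norm_ge_zero order_trans by blast
  show ?thesis
  proof (induction k)
    case 0
    show ?case using R0 L_eta_ge_1 \<rho>_bounds by simp
  next
    case (Suc k)
    have "norm (\<eta> (Suc k) - opt (\<xi> (Suc k)))
        \<le> norm (\<eta> (Suc k) - opt (\<xi> k)) + norm (opt (\<xi> k) - opt (\<xi> (Suc k)))"
      by (rule norm_diff_triangle_ineq[of _ "opt (\<xi> k)" "opt (\<xi> k)", simplified])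
    also have "\<dots> \<le> \<rho> * (?e + ?r) + lip\<eta> * R"
    proof (rule add_mono)
      show "norm (\<eta> (Suc k) - opt (\<xi> k)) \<le> \<rho> * (?e + ?r)"
        using contr[of k] Suc \<rho>_bounds by (meson less_imp_le mult_left_mono order_trans)
      show "norm (opt (\<xi> k) - opt (\<xi> (Suc k))) \<le> lip\<eta> * R"
        using opt_lipschitz[of "\<xi> k" "\<xi> (Suc k)"] R[of k] L_eta_ge_1
        by (smt (verit) mult_left_mono norm_minus_commute)
    qed
    also have "\<dots> = \<rho> * ?e + ?r"
      using \<rho>_bounds by (simp add: field_simps)
    also have "\<dots> \<le> ?e + ?r"
      using \<rho>_bounds by (simp add: mult_left_le_one_le)
    finally show ?case .
  qed
qed

end

section \<open>The alternating gradient method\<close>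

lemma ker_projection_mult:
  fixes A :: "real^'n^'m"
  shows "ker_projection A *v x = closest_point {v. A *v v = 0} x"
proof -
  have "subspace {v. A *v v = 0}"
    using solution_set_affine(1)[of 0 A 0] by simp
  from linear_closest_point_subspace[OF this] show ?thesis
    by (simp add: ker_projection_def matrix_works)
qed

lemma jacobian_mult:
  fixes f :: "real^'n \<Rightarrow> real^'m"
  assumes "(f has_derivative f') (at x)"
  shows "jacobian f (at x) *v h = f' h"
  unfolding jacobian_def frechet_derivative_at[OF assms, symmetric]
  using has_derivative_linear[OF assms] by (simp add: matrix_works linear_matrix_vector_mul_eq)

locale agm_problem =
  smooth_bilevel "{v. A *v v = 0}" H p L l1 l2 m \<tau> "{w. B *v w = 0}" \<Xi> q U u0 u1
  for A :: "real^'n^'m" and B :: "real^'u^'p" and H p L l1 l2 m \<tau> \<Xi> q U u0 u1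
begin

lemma grad_eta_L: "grad_eta L x \<xi> = G x \<xi>"
  by (simp add: G_def grad_eta_eq L_differentiable)

lemma inner_iter_Suc:
  "inner_iter H L \<tau> \<eta> \<xi> (Suc s)
    = closest_point H (inner_iter H L \<tau> \<eta> \<xi> s - \<tau> *\<^sub>R G (inner_iter H L \<tau> \<eta> \<xi> s) \<xi>)"
  by (simp add: grad_eta_L)

lemma hess_mult:
  "hess_eta_eta L x \<xi> *v v = M (x, \<xi>) (v, 0)" "hess_eta_xi L x \<xi> *v h = M (x, \<xi>) (0, h)"
  unfolding hess_eta_eta_def hess_eta_xi_def grad_eta_L
  by (intro jacobian_mult has_derivative_G_fst has_derivative_G_snd)+

lemma inner_jac_0: "inner_jac A H L \<tau> \<eta> \<xi> 0 *v h = 0"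
  by simp

text \<open>Linearity of the projection and of \<open>M\<close> merges the two matrix terms into the
  vector recursion required of \<open>Z\<close>.\<close>

lemma inner_jac_Suc:
  "inner_jac A H L \<tau> \<eta> \<xi> (Suc s) *v h
    = P (inner_jac A H L \<tau> \<eta> \<xi> s *v h
        - \<tau> *\<^sub>R M (inner_iter H L \<tau> \<eta> \<xi> s, \<xi>) (inner_jac A H L \<tau> \<eta> \<xi> s *v h, h))"
proof -
  let ?z = "(inner_iter H L \<tau> \<eta> \<xi> s, \<xi>)" and ?J = "inner_jac A H L \<tau> \<eta> \<xi> s *v h"
  have "inner_jac A H L \<tau> \<eta> \<xi> (Suc s) *v h = P (?J - \<tau> *\<^sub>R M ?z (?J, 0)) - \<tau> *\<^sub>R P (M ?z (0, h))"
    by (simp add: matrix_vector_mult_diff_rdistrib ker_projection_mult hess_mult scaleR_matrix_vector_assoc[symmetric]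
        flip: matrix_vector_mul_assoc)
  also have "\<dots> = P (?J - \<tau> *\<^sub>R (M ?z (?J, 0) + M ?z (0, h)))"
    by (simp add: P_diff P_scale P_add algebra_simps)
  also have "M ?z (?J, 0) + M ?z (0, h) = M ?z (?J, h)"
    using M_add[of ?z "(?J, 0)" "(0, h)"] by simp
  finally show ?thesis .
qed

lemma inner_hypergrad:
  "h \<bullet> hypergrad A H U L \<tau> s \<eta> \<xi>
    = (inner_jac A H L \<tau> \<eta> \<xi> s *v h, h) \<bullet> gradient U (inner_iter H L \<tau> \<eta> \<xi> s, \<xi>)"
  using dot_lmul_matrix[of "fst (gradient U (inner_iter H L \<tau> \<eta> \<xi> s, \<xi>))" "inner_jac A H L \<tau> \<eta> \<xi> s" h]
  by (simp add: hypergrad_def grad_eta_eq grad_xi_eq U_differentiable inner_add_right inner_prod_def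
      transpose_matrix_vector inner_commute)

lemma norm_inner_iter_error:
  "norm (inner_iter H L \<tau> \<eta> \<xi> s - opt \<xi>) \<le> \<rho> ^ s * norm (\<eta> - opt \<xi>)"
  using inner_loop_error[of "inner_iter H L \<tau> \<eta> \<xi>" \<xi> "\<lambda>s. (*v) (inner_jac A H L \<tau> \<eta> \<xi> s)" s,
      OF inner_iter_Suc inner_jac_0 inner_jac_Suc] by simp

lemma norm_hypergrad_le: "norm (hypergrad A H U L \<tau> s \<eta> \<xi>) \<le> u0 * (1 + 2 * lip\<eta>)"
  by (rule norm_hypergradient_le[of "inner_iter H L \<tau> \<eta> \<xi>" \<xi> "\<lambda>s. (*v) (inner_jac A H L \<tau> \<eta> \<xi> s)",
      OF inner_iter_Suc inner_jac_0 inner_jac_Suc inner_hypergrad])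

lemma norm_hypergrad_error:
  assumes "norm (\<eta> - opt \<xi>) \<le> D"
  shows "norm (hypergrad A H U L \<tau> s \<eta> \<xi> - gradient u \<xi>)
    \<le> (u1 * D * (1 + lip\<eta>) + u0 * (lip\<eta> + 4 * l2 * (1 + lip\<eta>) * D / m)) * \<sigma> ^ s"
  by (rule hypergradient_error[of "inner_iter H L \<tau> \<eta> \<xi>" \<xi> "\<lambda>s. (*v) (inner_jac A H L \<tau> \<eta> \<xi> s)",
      OF inner_iter_Suc inner_jac_0 inner_jac_Suc inner_hypergrad]) (simp add: assms)

text \<open>\<open>R\<close>, \<open>D\<close> and \<open>C\<close> involve the bound
  \<open>T\<close> but not \<open>t\<close>, \<open>Kl\<close> or \<open>n\<close>, so they stay
  fixed when the step size and the loop length vary with the number of iterations.\<close>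

lemma sum_residual_agm_le:
  fixes \<eta>1 :: "real^'n" and \<xi>1 :: "real^'u"
  assumes Kl: "Kl > 0" and t: "0 < t" "t \<le> T" "t * lipu \<le> 1 / 2"
    and lower: "\<And>x. x \<in> \<Xi> \<Longrightarrow> b \<le> u x"
  defines "R \<equiv> T * (u0 * (1 + 2 * lip\<eta>)) + norm (closest_point \<Xi> \<xi>1 - \<xi>1)"
  defines "D \<equiv> norm (\<eta>1 - opt \<xi>1) + lip\<eta> * R / (1 - \<rho>)"
  defines "C \<equiv> u1 * D * (1 + lip\<eta>) + u0 * (lip\<eta> + 4 * l2 * (1 + lip\<eta>) * D / m)"
  shows "(\<Sum>k=1..n. stationarity_residual \<Xi> u (agm_xi A H \<Xi> U L t \<tau> Kl \<eta>1 \<xi>1 k))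
    \<le> stationarity_residual \<Xi> u \<xi>1 + 2 / t * (u \<xi>1 + u0 * ((1 + lip\<eta>) * R) - b) + real n * (C * \<sigma> ^ Kl)\<^sup>2"
proof -
  define \<eta> where "\<eta> k = fst (agm A H \<Xi> U L t \<tau> Kl \<eta>1 \<xi>1 k)" for k
  define \<xi> where "\<xi> k = snd (agm A H \<Xi> U L t \<tau> Kl \<eta>1 \<xi>1 k)" for k
  define g where "g k = hypergrad A H U L \<tau> Kl (\<eta> k) (\<xi> k)" for k
  have init: "\<eta> 0 = \<eta>1" "\<xi> 0 = \<xi>1"
    by (simp_all add: \<eta>_def \<xi>_def)
  have \<eta>_Suc: "\<eta> (Suc k) = inner_iter H L \<tau> (\<eta> k) (\<xi> k) Kl"
    and \<xi>_Suc: "\<xi> (Suc k) = closest_point \<Xi> (\<xi> k - t *\<^sub>R g k)" for k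
    by (simp_all add: \<eta>_def \<xi>_def g_def case_prod_unfold Let_def)
  have step: "norm (\<xi> (Suc k) - \<xi> k) \<le> R" for k
    using upper_step_norm_le[of \<xi> t g T "u0 * (1 + 2 * lip\<eta>)" k, OF \<xi>_Suc] t norm_hypergrad_le
    by (simp add: R_def init g_def)
  have "norm (\<eta> k - opt (\<xi> k)) \<le> D" for k
    unfolding D_def init[symmetric]
  proof (rule tracking_error_bounded[of \<eta> \<xi>, OF _ step])
    fix k
    \<comment> \<open>At least one inner step is taken, so each inner loop contracts by
      \<open>\<rho>\<close> or better.\<close>
    have "\<rho> ^ Kl \<le> \<rho>"
      using Kl \<rho>_bounds power_decreasing[of 1 Kl \<rho>] by simp
    then show "norm (\<eta> (Suc k) - opt (\<xi> k)) \<le> \<rho> * norm (\<eta> k - opt (\<xi> k))"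
      unfolding \<eta>_Suc using norm_inner_iter_error
      by (meson mult_right_mono norm_ge_zero order_trans)
  qed
  then have err: "norm (g k - gradient u (\<xi> k)) \<le> C * \<sigma> ^ Kl" for k
    unfolding g_def C_def by (rule norm_hypergrad_error)
  have "u (\<xi> 1) \<le> u \<xi>1 + u0 * ((1 + lip\<eta>) * norm (\<xi> 1 - \<xi>1))"
    using u_lipschitz[of "\<xi> 1" \<xi>1] by linarith
  also have "\<dots> \<le> u \<xi>1 + u0 * ((1 + lip\<eta>) * R)"
    using step[of 0] L_eta_ge_1 u0_nonneg by (intro add_left_mono mult_left_mono) (auto simp: init)
  finally have u1: "2 / t * (u (\<xi> 1) - b) \<le> 2 / t * (u \<xi>1 + u0 * ((1 + lip\<eta>) * R) - b)"
    using t by (intro mult_left_mono) auto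
  have "(\<Sum>k=1..n. stationarity_residual \<Xi> u (agm_xi A H \<Xi> U L t \<tau> Kl \<eta>1 \<xi>1 k))
      = (\<Sum>k<n. stationarity_residual \<Xi> u (\<xi> k))"
    by (rule sum.reindex_bij_witness[of _ Suc "\<lambda>k. k - 1"]) (auto simp: agm_xi_def \<xi>_def)
  also have "\<dots> \<le> stationarity_residual \<Xi> u (\<xi> 0) + 2 / t * (u (\<xi> 1) - b) + real n * (C * \<sigma> ^ Kl)\<^sup>2"
    by (rule sum_residual_le[of \<xi> t g, OF \<xi>_Suc t(1,3) err lower])
  finally show ?thesis
    using u1 by (simp add: init)
qed

end


text \<open>Written as an exponential, the squared power has exponent
  \<open>2 * real K * ln \<sigma>\<close>, and the threshold on \<open>K\<close> pushes it below
  \<open>- ln (real n)\<close>.\<close>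

lemma power_le_sqrt_inverse:
  assumes \<sigma>: "0 < \<sigma>" "\<sigma> < (1 :: real)" and n: "n > 0" and K: "ln (real n) / (- 2 * ln \<sigma>) \<le> real K"
  shows "(\<sigma> ^ K)\<^sup>2 \<le> 1 / real n"
proof -
  have "ln \<sigma> < 0" using \<sigma> by simp
  then have "2 * real K * ln \<sigma> \<le> - ln (real n)"
    using K by (simp add: field_simps)
  moreover have "(\<sigma> ^ K)\<^sup>2 = exp (2 * real K * ln \<sigma>)"
    using \<sigma> exp_of_nat_mult[of "2 * K" "ln \<sigma>"] by (simp add: power_even_eq)
  ultimately have "(\<sigma> ^ K)\<^sup>2 \<le> exp (- ln (real n))"
    by simp
  then show ?thesis
    using n by (simp add: exp_minus inverse_eq_divide)
qed

theorem theorem5p6: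
  fixes A :: "real^'n^'m" and c :: "real^'m"
    and B :: "real^'u^'p" and e :: "real^'p"
    and H :: "(real^'n) set" and \<Xi> :: "(real^'u) set"
    and U L :: "(real^'n) \<times> (real^'u) \<Rightarrow> real"
    and lu0 lu1 ll1 ll2 \<mu>l \<tau>l :: real
  assumes "CARD('m) < CARD('n)"
    and "H = {\<eta>. A *v \<eta> = c}" and "\<Xi> = {\<xi>. B *v \<xi> = e}"
    and "H \<noteq> {}" and "\<Xi> \<noteq> {}"
    and "\<And>x. U differentiable (at x)"
    and "\<And>x. L differentiable (at x)"
    and "\<And>x. gradient L differentiable (at x)"
    and "lu0-lipschitz_on UNIV U"
    and "lu1-lipschitz_on UNIV (gradient U)"
    and "ll1-lipschitz_on UNIV (gradient L)"
    and "ll2-lipschitz_on UNIV (hessian L)"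
    and "\<mu>l > 0" and "\<And>\<xi>. strongly_convex_on UNIV \<mu>l (\<lambda>\<eta>. L (\<eta>, \<xi>))"
    and "bdd_below (bilevel_objective H U L ` \<Xi>)"
    and "0 < \<tau>l" and "\<tau>l \<le> 1 / (2 * ll1)"
  shows "\<exists>c0>0. \<forall>\<eta>1 \<xi>1. \<forall>(Kl :: nat \<Rightarrow> nat) (\<tau>u :: nat \<Rightarrow> real).
    (\<lambda>Ku. real (Kl Ku)) \<in> O(\<lambda>Ku. ln (real Ku)) \<longrightarrow>
    (\<forall>\<^sub>F Ku in sequentially. c0 * ln (real Ku) \<le> real (Kl Ku)) \<longrightarrow>
    \<tau>u \<in> \<Theta>(\<lambda>Ku. 1) \<longrightarrow>
    (\<forall>Ku. 0 < \<tau>u Ku \<and>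
       \<tau>u Ku \<le> min
         (1 / (2 * L_u lu0 lu1 ll1 ll2 \<mu>l * (1 + 2 * L_eta ll1 \<mu>l)))
         (\<tau>l * L_u lu0 lu1 ll1 ll2 \<mu>l * \<mu>l /
           (L_eta ll1 \<mu>l *
             ((lu1 * (1 + L_eta ll1 \<mu>l) + 2 * lu0 * C_K \<tau>l \<mu>l * C_l_squared ll1 ll2 \<mu>l)\<^sup>2
               + 4 * (L_u lu0 lu1 ll1 ll2 \<mu>l)\<^sup>2)))) \<longrightarrow>
    (\<lambda>Ku. 1 / real Ku * (\<Sum>k=1..Ku.
        stationarity_residual \<Xi> (bilevel_objective H U L)
          (agm_xi A H \<Xi> U L (\<tau>u Ku) \<tau>l (Kl Ku) \<eta>1 \<xi>1 k)))
      \<in> soft_O (\<lambda>Ku. 1 / real Ku)"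
proof -
  obtain p q where pq: "p \<in> H" "q \<in> \<Xi>"
    using assms(4,5) by blast
  interpret agm_problem A B H p L ll1 ll2 \<mu>l \<tau>l \<Xi> q U lu0 lu1
  proof unfold_locales
    show "subspace {v. A *v v = 0}" "H = {x. x - p \<in> {v. A *v v = 0}}"
      using solution_set_affine[of p A c] pq assms(2) by auto
    show "subspace {w. B *v w = 0}" "\<Xi> = {x. x - q \<in> {w. B *v w = 0}}"
      using solution_set_affine[of q B e] pq assms(3) by auto
  qed (use assms in auto)
  obtain b where b: "\<And>x. x \<in> \<Xi> \<Longrightarrow> b \<le> u x"
    using assms(15) unfolding bdd_below_def by blast
  \<comment> \<open>The threshold depends on \<open>\<tau>l\<close> and \<open>\<mu>l\<close> alone,
    so it can be fixed before the starting points and the sequences.\<close>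
  define c0 where "c0 = 1 / (- 2 * ln \<sigma>)"
  have c0: "c0 > 0"
    using \<sigma>_bounds by (simp add: c0_def zero_less_divide_iff)
  show ?thesis
  proof (intro exI[of _ c0] conjI allI impI c0)
    fix \<eta>1 \<xi>1 and Kl :: "nat \<Rightarrow> nat" and \<tau>u :: "nat \<Rightarrow> real"
    assume Kl: "\<forall>\<^sub>F Ku in sequentially. c0 * ln (real Ku) \<le> real (Kl Ku)"
      and \<Theta>: "\<tau>u \<in> \<Theta>(\<lambda>Ku. 1)"
      and \<tau>u: "\<forall>Ku. 0 < \<tau>u Ku \<and>
       \<tau>u Ku \<le> min
         (1 / (2 * L_u lu0 lu1 ll1 ll2 \<mu>l * (1 + 2 * L_eta ll1 \<mu>l)))
         (\<tau>l * L_u lu0 lu1 ll1 ll2 \<mu>l * \<mu>l /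
           (L_eta ll1 \<mu>l *
             ((lu1 * (1 + L_eta ll1 \<mu>l) + 2 * lu0 * C_K \<tau>l \<mu>l * C_l_squared ll1 ll2 \<mu>l)\<^sup>2
               + 4 * (L_u lu0 lu1 ll1 ll2 \<mu>l)\<^sup>2)))"
    define T where "T = 1 / (2 * lipu * (1 + 2 * lip\<eta>))"
    have T: "0 < \<tau>u n" "\<tau>u n \<le> T" for n
      using \<tau>u by (auto simp: T_def)
    have "T > 0"
      using T[of 0] by linarith
    \<comment> \<open>If \<open>lipu\<close> were 0, the division would make \<open>T\<close> equal
      to 0, contradicting the positive step sizes below it.\<close>
    then have lipu_pos: "lipu > 0"
      using L_u_nonneg by (cases "lipu = 0") (auto simp: T_def)
    have small: "\<tau>u n * lipu \<le> 1 / 2" for n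
    proof -
      have "\<tau>u n * lipu \<le> T * lipu"
        using T lipu_pos by (intro mult_right_mono) auto
      also have "\<dots> = 1 / (2 * (1 + 2 * lip\<eta>))"
        using lipu_pos by (simp add: T_def)
      also have "\<dots> \<le> 1 / 2"
        using L_eta_ge_1 by (intro divide_left_mono) auto
      finally show ?thesis .
    qed
    define R where "R = T * (lu0 * (1 + 2 * lip\<eta>)) + norm (closest_point \<Xi> \<xi>1 - \<xi>1)"
    define D where "D = norm (\<eta>1 - opt \<xi>1) + lip\<eta> * R / (1 - \<rho>)"
    define C where "C = lu1 * D * (1 + lip\<eta>) + lu0 * (lip\<eta> + 4 * ll2 * (1 + lip\<eta>) * D / \<mu>l)"
    define E where "E = \<bar>u \<xi>1 + lu0 * ((1 + lip\<eta>) * R) - b\<bar>"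
    define S where "S n = (\<Sum>k=1..n. stationarity_residual \<Xi> u (agm_xi A H \<Xi> U L (\<tau>u n) \<tau>l (Kl n) \<eta>1 \<xi>1 k))" for n
    \<comment> \<open>The lower half of the \<Theta> bound keeps the factor
      \<open>2 / \<tau>u n\<close> from the telescoped descent bounded.\<close>
    obtain a where a: "a > 0" "\<forall>\<^sub>F n in sequentially. a * norm (1 :: real) \<le> norm (\<tau>u n)"
      using \<Theta> by (auto simp: bigtheta_def elim: landau_omega.bigE)
    \<comment> \<open>The logarithmic exponent in \<open>soft_O\<close> is chosen as 0.\<close>
    have "\<forall>\<^sub>F n in sequentially. norm (1 / real n * S n)
        \<le> (stationarity_residual \<Xi> u \<xi>1 + 2 / a * E + C\<^sup>2) * norm (1 / real n * ln (real n) ^ 0)"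
      using a(2) Kl eventually_gt_at_top[of 1]
    proof eventually_elim
      case (elim n)
      have ln: "ln (real n) > 0" using elim by simp
      \<comment> \<open>For \<open>n > 1\<close> the logarithm is positive, and the lower bound on
        \<open>Kl n\<close> then excludes an empty inner loop.\<close>
      have "Kl n > 0"
        using elim mult_pos_pos[OF c0 ln] by (cases "Kl n") auto
      then have "S n \<le> stationarity_residual \<Xi> u \<xi>1
          + 2 / \<tau>u n * (u \<xi>1 + lu0 * ((1 + lip\<eta>) * R) - b) + real n * (C * \<sigma> ^ Kl n)\<^sup>2"
        unfolding S_def R_def D_def C_def by (intro sum_residual_agm_le T small b)
      also have "2 / \<tau>u n * (u \<xi>1 + lu0 * ((1 + lip\<eta>) * R) - b) \<le> 2 / a * E"
      proof (rule order_trans)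
        show "2 / \<tau>u n * (u \<xi>1 + lu0 * ((1 + lip\<eta>) * R) - b) \<le> 2 / \<tau>u n * E"
          using T[of n] unfolding E_def by (intro mult_left_mono) auto
        show "2 / \<tau>u n * E \<le> 2 / a * E"
          using a(1) elim T[of n] unfolding E_def by (intro mult_right_mono divide_left_mono) auto
      qed
      also have "real n * (C * \<sigma> ^ Kl n)\<^sup>2 \<le> C\<^sup>2"
      proof -
        have "(\<sigma> ^ Kl n)\<^sup>2 \<le> 1 / real n"
          using elim by (intro power_le_sqrt_inverse \<sigma>_bounds) (auto simp: c0_def)
        then have "real n * (C\<^sup>2 * (\<sigma> ^ Kl n)\<^sup>2) \<le> real n * (C\<^sup>2 * (1 / real n))"
          by (intro mult_left_mono) auto
        then show ?thesis
          using elim by (simp add: power_mult_distrib)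
      qed
      finally have "S n \<le> stationarity_residual \<Xi> u \<xi>1 + 2 / a * E + C\<^sup>2"
        by simp
      moreover have "S n \<ge> 0"
        unfolding S_def by (intro sum_nonneg) (simp add: stationarity_residual_def)
      ultimately show ?case
        by (simp add: divide_right_mono)
    qed
    then have "(\<lambda>n. 1 / real n * S n) \<in> O(\<lambda>n. 1 / real n * ln (real n) ^ 0)"
      by (rule bigoI)
    then show "(\<lambda>Ku. 1 / real Ku * (\<Sum>k=1..Ku.
        stationarity_residual \<Xi> u (agm_xi A H \<Xi> U L (\<tau>u Ku) \<tau>l (Kl Ku) \<eta>1 \<xi>1 k)))
      \<in> soft_O (\<lambda>Ku. 1 / real Ku)"
      unfolding soft_O_def S_def by blast
  qed
qed

end
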